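(* Let $M(t)=\sum_{j=1}^{N(1)}L_j(t-T_j)$, $t\ge 1$, be the Poisson cluster model with a non-homogeneous Poisson process $N$ with mean value function $\Lambda(\cdot)$ and i.i.d. non-homogeneous Poisson cluster processes $L_k$, $k=1,2,\ldots$, with mean value function $\mu(\cdot)$ (full setting in the context). Let $t\ge 1$, $s>0$ and $m\in\{1,2,\ldots\}$ with $P(M(t)=m)>0$. Then the prediction $\widehat M_m(t,t+s]:=E[M(t,t+s]\mid M(t)=m]$ equals $$\widehat M_m(t,t+s]=\frac{\phi^{(m+1,0)}_{R_{N(1)}(t),R_{N(1)}(t+s)}(1,0)-\phi^{(m,1)}_{R_{N(1)}(t),R_{N(1)}(t+s)}(1,0)}{\phi^{(m)}_{R_{N(1)}(t)}(1)},$$ and the conditional variance of $M(t,t+s]$ given $\{M(t)=m\}$ is $$\mathrm{Var}(M(t,t+s]\mid M(t)=m)=\frac{\phi^{(m+2,0)}_{R_{N(1)}(t),R_{N(1)}(t+s)}(1,0)-2\phi^{(m+1,1)}_{R_{N(1)}(t),R_{N(1)}(t+s)}(1,0)+\phi^{(m,2)}_{R_{N(1)}(t),R_{N(1)}(t+s)}(1,0)}{\phi^{(m)}_{R_{N(1)}(t)}(1)}+\widehat M_m(t,t+s]-\big(\widehat M_m(t,t+s]\big)^2 .$$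
   Context: Model: $0<T_1<T_2<\cdots$ are the points of a non-homogeneous Poisson process $N$ on $[0,\infty)$ with locally finite mean measure $\Lambda$; $\Lambda(1):=\Lambda[0,1]\in(0,\infty)$ and $N(1)=\#\{j:T_j\le1\}$. The $L_j$ are i.i.d. copies of a non-homogeneous Poisson process $L$ (independent increments, $L(0)=0$, $E[\mathrm{e}^{iuL(t)}]=\mathrm{e}^{\mu(t)(\mathrm{e}^{iu}-1)}$), $L_j(t)=0$ a.s. for $t\le0$, and $(T_j)$, $(L_j)$ are independent. The mean value function $\mu$ is nondecreasing and continuous with $\mu(0)=0$ and $\mu(0,\infty)=\lim_{t\to\infty}\mu(t)<\infty$. $M(t,t+s]=M(t+s)-M(t)$. Random sum: $R_{N(1)}(t)=\sum_{j=1}^{N(1)}\mu(t-V_j)$, $t\ge1$, where $(V_j)$ is i.i.d. with distribution $\Lambda(\mathrm{d}x)/\Lambda(1)$ on $[0,1]$, independent of $N$. Laplace transforms: $\phi_{Y_1,Y_2}(z_1,z_2)=E[\mathrm{e}^{-z_1Y_1-z_2Y_2}]$, $\phi_Y(z)=E[\mathrm{e}^{-zY}]$; $\phi^{(m,n)}_{Y_1,Y_2}$ denotes the $m$-th partial derivative in $z_1$ and $n$-th in $z_2$, and $\phi_Y^{(m)}$ the $m$-th derivative. *)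

theory Defs
  imports "HOL-Probability.Probability"
begin

text \<open>
  Sequences are indexed from \<open>0\<close>: \<open>T j\<close>, \<open>L j\<close>, \<open>V j\<close> stand for
  $T_{j+1}$, $L_{j+1}$, $V_{j+1}$. The points are extended reals, and \<open>T j \<omega> = \<infinity>\<close> means that
  \<open>\<omega>\<close> has at most \<open>j\<close> points, so that a finite total mass of the mean measure is allowed.
\<close>

definition point_count :: "(nat \<Rightarrow> 'w \<Rightarrow> ereal) \<Rightarrow> real set \<Rightarrow> 'w \<Rightarrow> nat" where
  "point_count T A \<omega> = card {j. T j \<omega> \<in> ereal ` A}"

text \<open>
  The local finiteness of the configuration is required explicitly because \<^const>\<open>card\<close> is \<open>0\<close>
  on infinite sets. The Poisson weights are written out because \<^const>\<open>poisson_pmf\<close> is only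
  specified for a positive rate.
\<close>

definition poisson_point_process ::
    "'w measure \<Rightarrow> real measure \<Rightarrow> (nat \<Rightarrow> 'w \<Rightarrow> ereal) \<Rightarrow> bool" where
  "poisson_point_process P \<Lambda> T \<longleftrightarrow>
     sets \<Lambda> = sets borel \<and>
     emeasure \<Lambda> {..<0} = 0 \<and>
     (\<forall>x. emeasure \<Lambda> {0..x} < \<infinity>) \<and>
     (\<forall>j. T j \<in> borel_measurable P) \<and>
     (AE \<omega> in P. 0 < T 0 \<omega> \<and>
        (\<forall>j. T j \<omega> < T (Suc j) \<omega> \<or> T j \<omega> = \<infinity> \<and> T (Suc j) \<omega> = \<infinity>) \<and>
        (\<forall>x::real. finite {j. T j \<omega> \<le> ereal x})) \<and>
     (\<forall>A \<in> sets borel. bounded A \<longrightarrow>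
        (\<forall>k. measure P {\<omega> \<in> space P. point_count T A \<omega> = k} =
              measure \<Lambda> A ^ k / fact k * exp (- measure \<Lambda> A))) \<and>
     (\<forall>A :: nat \<Rightarrow> real set. disjoint_family A \<and> (\<forall>i. A i \<in> sets borel \<and> bounded (A i)) \<longrightarrow>
        prob_space.indep_vars P (\<lambda>_. count_space UNIV) (\<lambda>i. point_count T (A i)) UNIV)"

text \<open>
  A Poisson process in counting form with mean value function \<open>\<mu>\<close>, extended by \<open>0\<close> to the
  negative half line.
\<close>

definition poisson_counting_process ::
    "'w measure \<Rightarrow> (real \<Rightarrow> real) \<Rightarrow> (real \<Rightarrow> 'w \<Rightarrow> nat) \<Rightarrow> bool" where
  "poisson_counting_process P \<mu> X \<longleftrightarrow>
     (\<forall>t. X t \<in> measurable P (count_space UNIV)) \<and>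
     (\<forall>\<omega> \<in> space P. mono (\<lambda>t. X t \<omega>) \<and> (\<forall>t. continuous (at_right t) (\<lambda>s. X s \<omega>))) \<and>
     (\<forall>t \<le> 0. AE \<omega> in P. X t \<omega> = 0) \<and>
     (\<forall>\<tau> :: nat \<Rightarrow> real. mono \<tau> \<and> 0 \<le> \<tau> 0 \<longrightarrow>
        prob_space.indep_vars P (\<lambda>_. borel)
          (\<lambda>i \<omega>. real (X (\<tau> (Suc i)) \<omega>) - real (X (\<tau> i) \<omega>)) UNIV) \<and>
     (\<forall>t \<ge> 0. \<forall>u. char (distr P borel (\<lambda>\<omega>. real (X t \<omega>))) u =
        exp (complex_of_real (\<mu> t) * (iexp u - 1)))"

text \<open>The value \<open>0\<close> on the negative half line extends a continuous mean value function on $[0,\infty)$.\<close>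

definition finite_mean_value_function :: "(real \<Rightarrow> real) \<Rightarrow> bool" where
  "finite_mean_value_function \<mu> \<longleftrightarrow>
     mono \<mu> \<and> continuous_on UNIV \<mu> \<and> (\<forall>t \<le> 0. \<mu> t = 0) \<and> (\<exists>c. (\<mu> \<longlongrightarrow> c) at_top)"

text \<open>
  The processes \<open>L j\<close> are independent as random elements of the product space over the time axis.
  They are identically distributed since the increments and \<open>\<mu>\<close> determine the
  finite-dimensional distributions.
\<close>

definition iid_poisson_clusters ::
    "'w measure \<Rightarrow> (real \<Rightarrow> real) \<Rightarrow> (nat \<Rightarrow> real \<Rightarrow> 'w \<Rightarrow> nat) \<Rightarrow> bool" where
  "iid_poisson_clusters P \<mu> L \<longleftrightarrow>
     (\<forall>j. poisson_counting_process P \<mu> (L j)) \<and>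
     prob_space.indep_vars P (\<lambda>_. PiM UNIV (\<lambda>_ :: real. count_space UNIV)) (\<lambda>j \<omega> t. L j t \<omega>) UNIV"

text \<open>The library's \<open>indep_var\<close> needs two random elements of the same type.\<close>

definition indep_elements ::
    "'w measure \<Rightarrow> 'a measure \<Rightarrow> ('w \<Rightarrow> 'a) \<Rightarrow> 'b measure \<Rightarrow> ('w \<Rightarrow> 'b) \<Rightarrow> bool" where
  "indep_elements P N1 X1 N2 X2 \<longleftrightarrow>
     prob_space.indep_set P
       {X1 -` B \<inter> space P | B. B \<in> sets N1} {X2 -` B \<inter> space P | B. B \<in> sets N2}"

definition cluster_process ::
    "(nat \<Rightarrow> 'w \<Rightarrow> ereal) \<Rightarrow> (nat \<Rightarrow> real \<Rightarrow> 'w \<Rightarrow> nat) \<Rightarrow> real \<Rightarrow> 'w \<Rightarrow> nat" where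
  "cluster_process T L t \<omega> =
     (\<Sum>j<point_count T {0..1} \<omega>. L j (t - real_of_ereal (T j \<omega>)) \<omega>)"

definition cluster_increment ::
    "(nat \<Rightarrow> 'w \<Rightarrow> ereal) \<Rightarrow> (nat \<Rightarrow> real \<Rightarrow> 'w \<Rightarrow> nat) \<Rightarrow> real \<Rightarrow> real \<Rightarrow> 'w \<Rightarrow> real" where
  "cluster_increment T L t s \<omega> =
     real (cluster_process T L (t + s) \<omega>) - real (cluster_process T L t \<omega>)"

definition random_sum ::
    "(nat \<Rightarrow> 'w \<Rightarrow> ereal) \<Rightarrow> (real \<Rightarrow> real) \<Rightarrow> (nat \<Rightarrow> 'w \<Rightarrow> real) \<Rightarrow> real \<Rightarrow> 'w \<Rightarrow> real" where
  "random_sum T \<mu> V t \<omega> = (\<Sum>j<point_count T {0..1} \<omega>. \<mu> (t - V j \<omega>))"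

definition laplace :: "'w measure \<Rightarrow> ('w \<Rightarrow> real) \<Rightarrow> real \<Rightarrow> real" where
  "laplace P Y z = (\<integral>\<omega>. exp (- z * Y \<omega>) \<partial>P)"

definition laplace2 ::
    "'w measure \<Rightarrow> ('w \<Rightarrow> real) \<Rightarrow> ('w \<Rightarrow> real) \<Rightarrow> real \<Rightarrow> real \<Rightarrow> real" where
  "laplace2 P Y1 Y2 z1 z2 = (\<integral>\<omega>. exp (- z1 * Y1 \<omega> - z2 * Y2 \<omega>) \<partial>P)"

definition nth_deriv :: "nat \<Rightarrow> (real \<Rightarrow> real) \<Rightarrow> real \<Rightarrow> real" where
  "nth_deriv m f = (deriv ^^ m) f"

definition mixed_deriv :: "nat \<Rightarrow> nat \<Rightarrow> (real \<Rightarrow> real \<Rightarrow> real) \<Rightarrow> real \<Rightarrow> real \<Rightarrow> real" where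
  "mixed_deriv m n f z1 z2 = nth_deriv m (\<lambda>x. nth_deriv n (f x) z2) z1"

text \<open>Conditioning on an event \<open>A\<close> of positive probability: \<^term>\<open>uniform_measure P A\<close> is $P(\cdot\mid A)$.\<close>

definition expectation_given :: "'w measure \<Rightarrow> 'w set \<Rightarrow> ('w \<Rightarrow> real) \<Rightarrow> real" where
  "expectation_given P A X = (\<integral>\<omega>. X \<omega> \<partial>uniform_measure P A)"

definition variance_given :: "'w measure \<Rightarrow> 'w set \<Rightarrow> ('w \<Rightarrow> real) \<Rightarrow> real" where
  "variance_given P A X = expectation_given P A (\<lambda>\<omega>. (X \<omega> - expectation_given P A X)\<^sup>2)"

end

theory Submission
  imports Defs
begin

text \<open>
  Given the points $T_j$, the numbers $M(t)$ and $M(t,t+s]$ are sums of independent Poisson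
  variables, hence independent Poisson variables with the random means
  $R=\sum_{j\le N(1)}\mu(t-T_j)$ and $D=\sum_{j\le N(1)}\mu(t-T_j,t+s-T_j]$. Thus the pair is mixed
  Poisson (\<open>mixed_poisson_joint_law\<close>),
  $$P(M(t)=m,\,M(t,t+s]=k)=E\Big[e^{-R}\frac{R^m}{m!}\,e^{-D}\frac{D^k}{k!}\Big],$$
  and since a Poisson variable with mean $D$ has second moment $D^2+D$, the moments of $M(t,t+s]$ on
  $\{M(t)=m\}$ are $E[R^mDe^{-R}]/m!$ and $E[R^m(D^2+D)e^{-R}]/m!$, where the event itself has
  probability $E[R^me^{-R}]/m!$ (\<open>conditional_moments\<close>). The extra summand $D$ is where the
  additional $\widehat M_m$ in the variance comes from.

  On the other side, with $R'=R+D$ the derivative of order $(i,j)$ of $E[e^{-z_1R-z_2R'}]$ at $(1,0)$ is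
  $(-1)^{i+j}E[R^iR'^je^{-R}]$, because $R$ and $R'$ are bounded by a multiple of the Poisson variable
  $N(1)$ and so have all exponential moments. Expanding $R^m(R'-R)$ and $R^m(R'-R)^2$ gives exactly the
  numerators of the theorem, up to the factor $(-1)^m$, which cancels (\<open>laplace2_derivatives\<close>).

  Two steps carry the remaining weight. The first is that the theorem uses i.i.d. marks $V_j$ in place
  of the ordered points $T_j$. Both enter only through sums $\sum_{j\le N(1)}h$ with a bounded continuous
  $h$, and both $E\exp\sum h(T_j)$ and $E\exp\sum h(V_j)$ equal
  $\exp\int_{[0,1]}(e^h-1)\,d\Lambda$ (\<open>point_process_laplace_functional\<close>,
  \<open>iid_marks_laplace_functional\<close>). The second is conditioning on the points, that is, evaluating
  $L_j$ at the random time $t-T_j$. Evaluation of a path at a variable time is not measurable on the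
  product space over the time axis, so the points are first rounded down to a grid; then only
  countably many times occur and Fubini applies. Rounding $T_j$ down moves $t-T_j$ to the right, so
  right-continuity of the paths recovers the original process in the limit (\<open>cluster_pgf\<close>).

  All distributions are compared through generating functions, where sums of independent variables
  become products; the joint law of $(M(t),M(t,t+s])$ is recovered at the end by comparing coefficients
  of power series, first in one variable and then in the other.
\<close>

section \<open>Poisson weights and generating functions\<close>

text \<open>
  A function of the rate, because the rates will be random. At rate \<open>0\<close> it is the unit mass at \<open>0\<close>.
\<close>
definition poisson_weight :: "real \<Rightarrow> nat \<Rightarrow> real" where
  "poisson_weight l k = l ^ k / fact k * exp (- l)"

lemma poisson_weight_nonneg: "0 \<le> l \<Longrightarrow> 0 \<le> poisson_weight l k"
  by (simp add: poisson_weight_def)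

lemma poisson_weight_measurable [measurable]:
  "(\<lambda>l. poisson_weight l k) \<in> borel_measurable borel"
  unfolding poisson_weight_def by measurable

lemma poisson_weight_pgf: "(\<lambda>k. x ^ k * poisson_weight l k) sums exp (l * (x - 1))"
proof -
  have "(\<lambda>k. (l * x) ^ k /\<^sub>R fact k * exp (- l)) sums (exp (l * x) * exp (- l))"
    by (intro sums_mult2 exp_converges)
  moreover have "(l * x) ^ k /\<^sub>R fact k * exp (- l) = x ^ k * poisson_weight l k" for k
    by (simp add: poisson_weight_def power_mult_distrib field_simps)
  moreover have "exp (l * x) * exp (- l) = exp (l * (x - 1))"
    by (simp add: mult_exp_exp algebra_simps)
  ultimately show ?thesis by simp
qed

lemma poisson_weight_Suc: "real (Suc k) * poisson_weight l (Suc k) = l * poisson_weight l k"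
  by (simp add: poisson_weight_def field_simps del: of_nat_Suc)

lemma poisson_weight_mean: "(\<lambda>k. real k * poisson_weight l k) sums l"
proof -
  have "(\<lambda>k. l * poisson_weight l k) sums (l * 1)"
    using poisson_weight_pgf[of 1 l] by (intro sums_mult) simp
  then have "(\<lambda>k. real (Suc k) * poisson_weight l (Suc k)) sums l"
    by (simp add: poisson_weight_Suc del: of_nat_Suc)
  then show ?thesis
    by (subst (asm) sums_Suc_iff) simp
qed

lemma poisson_weight_second_moment: "(\<lambda>k. (real k)\<^sup>2 * poisson_weight l k) sums (l\<^sup>2 + l)"
proof -
  have "(\<lambda>k. l * (real k * poisson_weight l k) + l * poisson_weight l k) sums (l * l + l * 1)"
    using poisson_weight_pgf[of 1 l] by (intro sums_mult sums_add poisson_weight_mean) simp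
  moreover have "l * (real k * poisson_weight l k) + l * poisson_weight l k
      = (real (Suc k))\<^sup>2 * poisson_weight l (Suc k)" for k
  proof -
    have "(real (Suc k))\<^sup>2 * poisson_weight l (Suc k) = real (Suc k) * (l * poisson_weight l k)"
      by (simp add: power2_eq_square poisson_weight_Suc mult.assoc del: of_nat_Suc)
    then show ?thesis by (simp add: algebra_simps)
  qed
  ultimately have "(\<lambda>k. (real (Suc k))\<^sup>2 * poisson_weight l (Suc k)) sums (l\<^sup>2 + l)"
    by (simp add: power2_eq_square del: of_nat_Suc)
  then show ?thesis
    by (subst (asm) sums_Suc_iff) simp
qed

text \<open>
  The identity is only known on \<open>{0<..<1}\<close>, since generating functions are evaluated at
  positive arguments. If the coefficients below \<open>n\<close> agree, the difference series divided by \<open>x ^ n\<close>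
  vanishes on this interval, while its limit at \<open>0\<close> is the difference of the \<open>n\<close>-th coefficients.
\<close>
lemma power_series_coeff_unique:
  fixes p q :: "nat \<Rightarrow> real"
  assumes p: "\<And>x. 0 < x \<Longrightarrow> x < 1 \<Longrightarrow> (\<lambda>k. p k * x ^ k) sums S x"
    and q: "\<And>x. 0 < x \<Longrightarrow> x < 1 \<Longrightarrow> (\<lambda>k. q k * x ^ k) sums S x"
  shows "p n = q n"
proof (induction n rule: less_induct)
  case (less n)
  define c where "c k = p (k + n) - q (k + n)" for k
  have c0: "(\<lambda>k. c k * x ^ k) sums 0" if x: "0 < x" "x < 1" for x
  proof -
    have "(\<lambda>k. p k * x ^ k - q k * x ^ k) sums (S x - S x)"
      by (intro sums_diff p q x)
    then have "(\<lambda>k. p (k + n) * x ^ (k + n) - q (k + n) * x ^ (k + n)) sums 0"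
      using less by (subst sums_zero_iff_shift) auto
    then have "(\<lambda>k. (p (k + n) * x ^ (k + n) - q (k + n) * x ^ (k + n)) / x ^ n) sums (0 / x ^ n)"
      by (rule sums_divide)
    moreover have "(p (k + n) * x ^ (k + n) - q (k + n) * x ^ (k + n)) / x ^ n = c k * x ^ k" for k
      using x by (simp add: c_def power_add field_simps)
    ultimately show ?thesis by simp
  qed
  have "summable (\<lambda>k. c k * x ^ k)" if "norm x < 1" for x
    using powser_inside[OF sums_summable[OF c0[of "(1 + norm x) / 2"]], of x] that by simp
  then have "((\<lambda>x. \<Sum>k. c k * x ^ k) \<longlongrightarrow> c 0) (at 0)"
    by (intro powser_limit_0[of 1]) (auto simp: summable_sums)
  then have "((\<lambda>x. \<Sum>k. c k * x ^ k) \<longlongrightarrow> c 0) (at_right 0)"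
    by (rule filterlim_mono) (auto simp: at_le)
  moreover have "eventually (\<lambda>x. (\<Sum>k. c k * x ^ k) = 0) (at_right 0)"
    unfolding eventually_at_right_field using c0 by (intro exI[of _ 1]) (auto simp: sums_iff)
  ultimately have "((\<lambda>x::real. 0) \<longlongrightarrow> c 0) (at_right 0)"
    by (rule Lim_transform_eventually)
  then have "c 0 = 0"
    by (simp add: tendsto_const_iff)
  then show ?case
    by (simp add: c_def)
qed

lemma nn_integral_nat_valued:
  fixes f :: "nat \<Rightarrow> ennreal"
  assumes [measurable]: "X \<in> measurable M (count_space UNIV)" "B \<in> sets M"
  shows "(\<integral>\<^sup>+\<omega>. f (X \<omega>) * indicator B \<omega> \<partial>M) = (\<Sum>k. f k * emeasure M {\<omega>\<in>B. X \<omega> = k})"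
proof -
  have [simp]: "{\<omega>\<in>B. X \<omega> = k} \<in> sets M" for k
  proof -
    have "{\<omega>\<in>B. X \<omega> = k} = B \<inter> {\<omega>\<in>space M. X \<omega> = k}"
      using sets.sets_into_space[OF assms(2)] by auto
    then show ?thesis by simp
  qed
  have "(\<integral>\<^sup>+\<omega>. f (X \<omega>) * indicator B \<omega> \<partial>M)
      = (\<integral>\<^sup>+\<omega>. (\<Sum>k. f k * indicator {\<omega>\<in>B. X \<omega> = k} \<omega>) \<partial>M)"
  proof (intro nn_integral_cong)
    fix \<omega>
    have "(\<lambda>k. f k * indicator {\<omega>\<in>B. X \<omega> = k} \<omega>) sums (f (X \<omega>) * indicator B \<omega>)"
      using sums_single[of "X \<omega>" "\<lambda>k. f k * indicator B \<omega>"]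
      by (rule sums_cong[THEN iffD1, rotated]) (auto simp: indicator_def)
    then show "f (X \<omega>) * indicator B \<omega> = (\<Sum>k. f k * indicator {\<omega>\<in>B. X \<omega> = k} \<omega>)"
      by (simp add: sums_iff)
  qed
  also have "\<dots> = (\<Sum>k. f k * emeasure M {\<omega>\<in>B. X \<omega> = k})"
    by (subst nn_integral_suminf) (auto simp: nn_integral_cmult_indicator)
  finally show ?thesis .
qed

lemma (in prob_space) has_bochner_integral_nat_valued:
  assumes X [measurable]: "X \<in> measurable M (count_space UNIV)" and B [measurable]: "B \<in> events"
    and f: "\<And>k. 0 \<le> f k" and S: "(\<lambda>k. f k * prob {\<omega>\<in>B. X \<omega> = k}) sums S"
  shows "has_bochner_integral M (\<lambda>\<omega>. f (X \<omega>) * indicator B \<omega>) S"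
proof (rule has_bochner_integral_nn_integral)
  have "(\<integral>\<^sup>+\<omega>. ennreal (f (X \<omega>) * indicator B \<omega>) \<partial>M)
      = (\<integral>\<^sup>+\<omega>. ennreal (f (X \<omega>)) * indicator B \<omega> \<partial>M)"
    by (intro nn_integral_cong) (simp add: indicator_def)
  also have "\<dots> = (\<Sum>k. ennreal (f k * prob {\<omega>\<in>B. X \<omega> = k}))"
    by (subst nn_integral_nat_valued) (auto simp: emeasure_eq_measure ennreal_mult f)
  also have "\<dots> = ennreal S"
    by (intro suminf_ennreal_eq S) (simp add: f)
  finally show "(\<integral>\<^sup>+\<omega>. ennreal (f (X \<omega>) * indicator B \<omega>) \<partial>M) = ennreal S" .
  show "0 \<le> S" by (rule sums_le[OF _ sums_zero S]) (simp add: f)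
qed (auto simp: f)

text \<open>
  Summing the generating series of the weights; \<open>x > 1\<close> is included because exponential moments of the number
  of points will serve as dominating functions.
\<close>
lemma (in prob_space) poisson_pgf:
  assumes X: "X \<in> measurable M (count_space UNIV)"
    and P: "\<And>k. prob {\<omega>\<in>space M. X \<omega> = k} = poisson_weight l k" and x: "0 \<le> x"
  shows "has_bochner_integral M (\<lambda>\<omega>. x ^ X \<omega>) (exp (l * (x - 1)))"
proof -
  have "has_bochner_integral M (\<lambda>\<omega>. x ^ X \<omega> * indicator (space M) \<omega>) (exp (l * (x - 1)))"
    using X x poisson_weight_pgf[of x l] by (intro has_bochner_integral_nat_valued) (auto simp: P)
  then show ?thesis
    by (rule has_bochner_integral_cong[THEN iffD1, rotated -1]) auto
qed

text \<open>
  The terms and the partial sums are dominated by the sum, so its integrability is enough to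
  exchange series and integral.
\<close>
lemma nonneg_sums_integral:
  fixes f :: "nat \<Rightarrow> 'a \<Rightarrow> real"
  assumes [measurable]: "\<And>k. f k \<in> borel_measurable M" and f: "\<And>k \<omega>. \<omega> \<in> space M \<Longrightarrow> 0 \<le> f k \<omega>"
    and sums: "\<And>\<omega>. \<omega> \<in> space M \<Longrightarrow> (\<lambda>k. f k \<omega>) sums g \<omega>" and g: "integrable M g"
  shows "(\<lambda>k. \<integral>\<omega>. f k \<omega> \<partial>M) sums (\<integral>\<omega>. g \<omega> \<partial>M)"
proof -
  have partial_le: "(\<Sum>k<n. f k \<omega>) \<le> g \<omega>" if "\<omega> \<in> space M" for n \<omega>
    using sum_le_suminf[OF sums_summable[OF sums[OF that]], of "{..<n}"] f[OF that] sums_unique[OF sums[OF that]]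
    by simp
  have int: "integrable M (f k)" for k
  proof (rule Bochner_Integration.integrable_bound[OF g])
    have "f k \<omega> \<le> g \<omega>" if "\<omega> \<in> space M" for \<omega>
      using partial_le[OF that, of "Suc k"] sum_nonneg[of "{..<k}" "\<lambda>k. f k \<omega>"] f[OF that] by simp
    then show "AE \<omega> in M. norm (f k \<omega>) \<le> norm (g \<omega>)"
      using f by (intro AE_I2) (auto intro: order_trans[OF _ abs_ge_self])
  qed measurable
  have "(\<lambda>k. \<integral>\<omega>. f k \<omega> \<partial>M) sums (\<integral>\<omega>. (\<Sum>k. f k \<omega>) \<partial>M)"
  proof (rule sums_integral[OF int])
    show "AE \<omega> in M. summable (\<lambda>k. norm (f k \<omega>))"
      using f sums by (intro AE_I2) (simp add: sums_iff)
    have "(\<Sum>k<n. \<integral>\<omega>. norm (f k \<omega>) \<partial>M) \<le> (\<integral>\<omega>. g \<omega> \<partial>M)" for n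
    proof -
      have "(\<Sum>k<n. \<integral>\<omega>. norm (f k \<omega>) \<partial>M) = (\<Sum>k<n. \<integral>\<omega>. f k \<omega> \<partial>M)"
        using f by (intro sum.cong Bochner_Integration.integral_cong) auto
      also have "\<dots> = (\<integral>\<omega>. (\<Sum>k<n. f k \<omega>) \<partial>M)"
        using int by simp
      also have "\<dots> \<le> (\<integral>\<omega>. g \<omega> \<partial>M)"
        using int g partial_le by (intro integral_mono) auto
      finally show ?thesis .
    qed
    then have "(\<Sum>k\<le>n. \<integral>\<omega>. norm (f k \<omega>) \<partial>M) \<le> (\<integral>\<omega>. g \<omega> \<partial>M)" for n
      unfolding lessThan_Suc_atMost[symmetric] .
    then show "summable (\<lambda>k. \<integral>\<omega>. norm (f k \<omega>) \<partial>M)"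
      by (intro bounded_imp_summable[where B = "\<integral>\<omega>. g \<omega> \<partial>M"] integral_nonneg_AE) auto
  qed
  moreover have "(\<integral>\<omega>. (\<Sum>k. f k \<omega>) \<partial>M) = (\<integral>\<omega>. g \<omega> \<partial>M)"
    using sums by (intro Bochner_Integration.integral_cong) (auto simp: sums_iff)
  ultimately show ?thesis by simp
qed

section \<open>Independent elements and the Poisson characteristic function\<close>

text \<open>
  Both measures give \<open>A \<times> B\<close> the product of the two probabilities, and rectangles determine
  a product of \<open>\<sigma>\<close>-finite measures.
\<close>
lemma (in prob_space) indep_elements_joint_law:
  assumes X1 [measurable]: "X1 \<in> measurable M N1" and X2 [measurable]: "X2 \<in> measurable M N2"
    and ind: "indep_elements M N1 X1 N2 X2"
  shows "distr M N1 X1 \<Otimes>\<^sub>M distr M N2 X2 = distr M (N1 \<Otimes>\<^sub>M N2) (\<lambda>\<omega>. (X1 \<omega>, X2 \<omega>))"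
proof (rule pair_measure_eqI)
  interpret D1: prob_space "distr M N1 X1" by (rule prob_space_distr) simp
  interpret D2: prob_space "distr M N2 X2" by (rule prob_space_distr) simp
  show "sigma_finite_measure (distr M N1 X1)" "sigma_finite_measure (distr M N2 X2)"
    by unfold_locales
  fix A B assume "A \<in> sets (distr M N1 X1)" "B \<in> sets (distr M N2 X2)"
  then have [measurable]: "A \<in> sets N1" "B \<in> sets N2" by auto
  have "prob ((X1 -` A \<inter> space M) \<inter> (X2 -` B \<inter> space M))
      = prob (X1 -` A \<inter> space M) * prob (X2 -` B \<inter> space M)"
    using ind unfolding indep_elements_def by (rule indep_setD) auto
  moreover have "(\<lambda>\<omega>. (X1 \<omega>, X2 \<omega>)) -` (A \<times> B) \<inter> space M
      = (X1 -` A \<inter> space M) \<inter> (X2 -` B \<inter> space M)"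
    by auto
  ultimately show "emeasure (distr M N1 X1) A * emeasure (distr M N2 X2) B
      = emeasure (distr M (N1 \<Otimes>\<^sub>M N2) (\<lambda>\<omega>. (X1 \<omega>, X2 \<omega>))) (A \<times> B)"
    by (simp add: emeasure_distr emeasure_eq_measure ennreal_mult)
qed auto

text \<open>
  Conditioning on the first of two independent elements: the second is averaged while the first
  is held fixed.
\<close>
lemma (in prob_space) indep_elements_integral:
  fixes F :: "'b \<Rightarrow> 'c \<Rightarrow> real"
  assumes X1 [measurable]: "X1 \<in> measurable M N1" and X2 [measurable]: "X2 \<in> measurable M N2"
    and ind: "indep_elements M N1 X1 N2 X2"
    and F [measurable]: "case_prod F \<in> borel_measurable (N1 \<Otimes>\<^sub>M N2)"
    and int: "integrable M (\<lambda>\<omega>. F (X1 \<omega>) (X2 \<omega>))"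
  shows "expectation (\<lambda>\<omega>. F (X1 \<omega>) (X2 \<omega>)) = expectation (\<lambda>\<omega>. expectation (\<lambda>\<omega>'. F (X1 \<omega>) (X2 \<omega>')))"
proof -
  interpret D1: prob_space "distr M N1 X1" by (rule prob_space_distr) simp
  interpret D2: prob_space "distr M N2 X2" by (rule prob_space_distr) simp
  interpret pair_sigma_finite "distr M N1 X1" "distr M N2 X2" by unfold_locales
  note law = indep_elements_joint_law[OF X1 X2 ind]
  have "integrable (distr M N1 X1 \<Otimes>\<^sub>M distr M N2 X2) (case_prod F)"
    unfolding law using int by (subst integrable_distr_eq) auto
  then have "(\<integral>x. \<integral>y. F x y \<partial>distr M N2 X2 \<partial>distr M N1 X1)
      = integral\<^sup>L (distr M N1 X1 \<Otimes>\<^sub>M distr M N2 X2) (case_prod F)"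
    by (rule integral_fst)
  also have "\<dots> = expectation (\<lambda>\<omega>. F (X1 \<omega>) (X2 \<omega>))"
    unfolding law by (subst integral_distr) auto
  also have "(\<integral>x. \<integral>y. F x y \<partial>distr M N2 X2 \<partial>distr M N1 X1)
      = (\<integral>\<omega>. \<integral>y. F (X1 \<omega>) y \<partial>distr M N2 X2 \<partial>M)"
    by (subst integral_distr) auto
  also have "\<dots> = (\<integral>\<omega>. \<integral>\<omega>'. F (X1 \<omega>) (X2 \<omega>') \<partial>M \<partial>M)"
    using X1[THEN measurable_space] by (intro Bochner_Integration.integral_cong integral_distr) auto
  finally show ?thesis by simp
qed

text \<open>
  A Poisson law for every rate in \<open>[0, \<infinity>)\<close>; rate \<open>0\<close> occurs here because mean value functions
  may vanish.
\<close>
lemma poisson_pmf_exists: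
  fixes l :: real assumes "0 \<le> l"
  obtains p :: "nat pmf" where "\<And>k. pmf p k = poisson_weight l k"
proof
  show "pmf (embed_pmf (poisson_weight l)) k = poisson_weight l k" for k
  proof (rule pmf_embed_pmf)
    have "(\<integral>\<^sup>+k. ennreal (poisson_weight l k) \<partial>count_space UNIV) = (\<Sum>k. ennreal (poisson_weight l k))"
      by (rule nn_integral_count_space_nat)
    also have "\<dots> = ennreal 1"
      using poisson_weight_pgf[of 1 l] assms by (intro suminf_ennreal_eq) (auto simp: poisson_weight_nonneg)
    finally show "(\<integral>\<^sup>+k. ennreal (poisson_weight l k) \<partial>count_space UNIV) = 1" by simp
  qed (simp add: assms poisson_weight_nonneg)
qed

text \<open>
  The clusters are specified by characteristic functions, but the proof works with probabilities of
  single values; Levy's uniqueness theorem connects the two.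
\<close>
lemma (in prob_space) poisson_law_of_char:
  fixes X :: "'a \<Rightarrow> nat"
  assumes X [measurable]: "X \<in> measurable M (count_space UNIV)" and l: "0 \<le> l"
    and char: "\<And>u. char (distr M borel (\<lambda>\<omega>. real (X \<omega>))) u = exp (complex_of_real l * (iexp u - 1))"
  shows "prob {\<omega>\<in>space M. X \<omega> = k} = poisson_weight l k"
proof -
  obtain p :: "nat pmf" where p: "\<And>k. pmf p k = poisson_weight l k"
    using poisson_pmf_exists[OF l] by blast
  define Q where "Q = distr (measure_pmf p) borel real"
  interpret Q: real_distribution Q
    unfolding Q_def by (rule real_distribution.intro; (rule prob_space.prob_space_distr)?)
       (auto simp: measure_pmf.prob_space_axioms real_distribution_axioms_def)
  have charQ: "char Q u = exp (complex_of_real l * (iexp u - 1))" for u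
  proof -
    have "char Q u = (\<integral>k. iexp (u * real k) \<partial>measure_pmf p)"
      unfolding char_def Q_def by (subst integral_distr) auto
    also have "\<dots> = (\<Sum>k. pmf p k *\<^sub>R iexp (u * real k))"
    proof -
      have "summable (\<lambda>k. norm (pmf p k *\<^sub>R iexp (u * real k)))"
        using sums_summable[OF poisson_weight_pgf[of 1 l]] by (simp add: p poisson_weight_nonneg l)
      then have "integrable (count_space UNIV) (\<lambda>k. pmf p k *\<^sub>R iexp (u * real k))"
        by (simp add: integrable_count_space_nat_iff)
      then show ?thesis
        by (simp add: measure_pmf_eq_density integral_density integral_count_space_nat)
    qed
    also have "\<dots> = exp (complex_of_real l * (iexp u - 1))"
    proof -
      have "(\<lambda>k. (l * iexp u) ^ k /\<^sub>R fact k * exp (- complex_of_real l))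
          sums (exp (l * iexp u) * exp (- complex_of_real l))"
        by (intro sums_mult2 exp_converges)
      moreover have "(l * iexp u) ^ k /\<^sub>R fact k * exp (- complex_of_real l) = pmf p k *\<^sub>R iexp (u * real k)" for k
        unfolding p poisson_weight_def scaleR_conv_of_real
        by (simp add: power_mult_distrib exp_of_nat_mult[symmetric] exp_of_real[symmetric] field_simps)
      moreover have "exp (l * iexp u) * exp (- complex_of_real l) = exp (complex_of_real l * (iexp u - 1))"
        by (simp add: mult_exp_exp algebra_simps)
      ultimately show ?thesis by (simp add: sums_iff)
    qed
    finally show ?thesis .
  qed
  have "distr M borel (\<lambda>\<omega>. real (X \<omega>)) = Q"
    by (intro Levy_uniqueness real_distribution_distr) (auto simp: char charQ Q.real_distribution_axioms fun_eq_iff)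
  then have "measure (distr M borel (\<lambda>\<omega>. real (X \<omega>))) {real k} = measure Q {real k}"
    by simp
  moreover have "measure (distr M borel (\<lambda>\<omega>. real (X \<omega>))) {real k} = prob {\<omega>\<in>space M. X \<omega> = k}"
    by (subst measure_distr) (auto intro!: arg_cong[where f=prob])
  moreover have "measure Q {real k} = pmf p k"
  proof -
    have "measure Q {real k} = measure (measure_pmf p) (real -` {real k})"
      unfolding Q_def by (subst measure_distr) auto
    also have "real -` {real k} = {k}" by auto
    finally show ?thesis by (simp add: measure_pmf_single)
  qed
  ultimately show ?thesis by (simp add: p)
qed

section \<open>Increments of a Poisson counting process\<close>

text \<open>
  The characteristic function is prescribed for \<open>t \<ge> 0\<close> only. For negative times both the process and the rate are zero, in accordance with a Poisson law of rate \<open>0\<close>.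
\<close>
lemma (in prob_space) counting_process_law:
  assumes X: "poisson_counting_process M \<mu> X" and \<mu>: "mono \<mu>" "\<And>t. t \<le> 0 \<Longrightarrow> \<mu> t = 0"
  shows "prob {\<omega>\<in>space M. X t \<omega> = k} = poisson_weight (\<mu> t) k"
proof -
  have [measurable]: "X t \<in> measurable M (count_space UNIV)"
    using X by (auto simp: poisson_counting_process_def)
  have nonneg: "0 \<le> \<mu> t"
    using monoD[OF \<mu>(1), of "min t 0" t] \<mu>(2)[of "min t 0"] by simp
  show ?thesis
  proof (cases "0 \<le> t")
    case True
    then show ?thesis
      using X nonneg by (intro poisson_law_of_char) (auto simp: poisson_counting_process_def)
  next
    case False
    then have AE: "AE \<omega> in M. X t \<omega> = 0"
      using X by (auto simp: poisson_counting_process_def)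
    have "prob {\<omega>\<in>space M. X t \<omega> = k} = (if k = 0 then 1 else 0)"
    proof (cases "k = 0")
      case True
      then show ?thesis using AE by (simp add: prob_Collect_eq_1)
    next
      case False
      with AE have "AE \<omega> in M. X t \<omega> \<noteq> k" by auto
      then show ?thesis using False by (simp add: prob_Collect_eq_0)
    qed
    then show ?thesis
      using False \<mu>(2)[of t] by (simp add: poisson_weight_def power_0_left)
  qed
qed

text \<open>
  By independence of the increments over \<open>[0, a]\<close> and \<open>[a, b]\<close> the joint generating function
  factorizes.
\<close>
lemma (in prob_space) counting_process_pgf_increments:
  assumes X: "poisson_counting_process M \<mu> X" and \<mu>: "mono \<mu>" "\<And>t. t \<le> 0 \<Longrightarrow> \<mu> t = 0"
    and ab: "a \<le> b" and x: "0 < x" "x \<le> 1" and y: "0 < y" "y \<le> 1"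
  shows "expectation (\<lambda>\<omega>. x ^ X a \<omega> * y ^ (X b \<omega> - X a \<omega>))
     = exp (\<mu> a * (x - 1) + (\<mu> b - \<mu> a) * (y - 1))"
proof -
  have X_meas [measurable]: "X t \<in> measurable M (count_space UNIV)" for t
    using X by (auto simp: poisson_counting_process_def)
  have mono: "X c \<omega> \<le> X d \<omega>" if "\<omega> \<in> space M" "c \<le> d" for c d \<omega>
    using X that by (auto simp: poisson_counting_process_def mono_def)
  have zero: "AE \<omega> in M. X t \<omega> = 0" if "t \<le> 0" for t
    using X that by (auto simp: poisson_counting_process_def)
  have pgf: "expectation (\<lambda>\<omega>. z ^ X t \<omega>) = exp (\<mu> t * (z - 1))" if "0 \<le> z" for z t
    using poisson_pgf[OF X_meas counting_process_law[OF X \<mu>] that] by (rule has_bochner_integral_integral_eq)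
  show ?thesis
  proof (cases "0 \<le> a")
    case False
    with zero[of a] have "expectation (\<lambda>\<omega>. x ^ X a \<omega> * y ^ (X b \<omega> - X a \<omega>)) = expectation (\<lambda>\<omega>. y ^ X b \<omega>)"
      by (intro integral_cong_AE) auto
    with False show ?thesis using y \<mu>(2)[of a] by (simp add: pgf)
  next
    case True
    define \<tau> :: "nat \<Rightarrow> real" where "\<tau> i = (if i = 0 then 0 else if i = 1 then a else b)" for i
    define I where "I i \<omega> = real (X (\<tau> (Suc i)) \<omega>) - real (X (\<tau> i) \<omega>)" for i \<omega>
    have "mono \<tau>" "0 \<le> \<tau> 0"
      using True ab by (auto simp: \<tau>_def mono_def)
    then have indep: "indep_vars (\<lambda>_. borel) I UNIV"
      using X unfolding poisson_counting_process_def I_def by blast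
    have I_nonneg: "0 \<le> I i \<omega>" if "\<omega> \<in> space M" for i \<omega>
      using mono[OF that monoD[OF \<open>mono \<tau>\<close>, of i "Suc i"]] by (simp add: I_def)
    have prod: "expectation (\<lambda>\<omega>. c powr I 0 \<omega> * d powr I 1 \<omega>)
        = expectation (\<lambda>\<omega>. c powr I 0 \<omega>) * expectation (\<lambda>\<omega>. d powr I 1 \<omega>)"
      if c: "0 < c" "c \<le> 1" and d: "0 < d" "d \<le> 1" for c d :: real
    proof -
      define Y where "Y i \<omega> = (if i = 0 then c else d) powr I i \<omega>" for i \<omega>
      have "indep_vars (\<lambda>_. borel) Y {0, 1}"
        unfolding Y_def using indep_vars_compose2[OF indep_vars_subset[OF indep subset_UNIV],
            of "{0,1}" "\<lambda>i z. (if i = 0 then c else d) powr z"] by simp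
      moreover have "integrable M (Y i)" for i
      proof (rule integrable_const_bound[where B = 1])
        show "AE \<omega> in M. norm (Y i \<omega>) \<le> 1"
          using c d I_nonneg by (intro AE_I2) (auto simp: Y_def intro!: powr_le1)
        show "Y i \<in> borel_measurable M"
          unfolding Y_def I_def by measurable
      qed
      ultimately have "expectation (\<lambda>\<omega>. \<Prod>i\<in>{0, 1}. Y i \<omega>) = (\<Prod>i\<in>{0, 1}. expectation (Y i))"
        by (intro indep_vars_lebesgue_integral) auto
      then show ?thesis by (simp add: Y_def[abs_def])
    qed
    have I0: "AE \<omega> in M. c powr I 0 \<omega> = c ^ X a \<omega>" if "0 < c" for c :: real
      using zero[OF order_refl] by eventually_elim (use that in \<open>simp add: I_def \<tau>_def powr_realpow\<close>)
    have I1: "c powr I 1 \<omega> = c ^ (X b \<omega> - X a \<omega>)" if "\<omega> \<in> space M" "0 < c" for c :: real and \<omega>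
      using mono[OF that(1) ab] that(2) by (simp add: I_def \<tau>_def powr_realpow[symmetric] of_nat_diff)
    have E0: "expectation (\<lambda>\<omega>. c powr I 0 \<omega>) = exp (\<mu> a * (c - 1))" if "0 < c" for c
    proof -
      have "expectation (\<lambda>\<omega>. c powr I 0 \<omega>) = expectation (\<lambda>\<omega>. c ^ X a \<omega>)"
        by (intro integral_cong_AE I0 that) (auto simp: I_def)
      then show ?thesis using that by (simp add: pgf)
    qed
    have joint: "expectation (\<lambda>\<omega>. c powr I 0 \<omega> * d powr I 1 \<omega>)
        = expectation (\<lambda>\<omega>. c ^ X a \<omega> * d ^ (X b \<omega> - X a \<omega>))" if "0 < c" "0 < d" for c d :: real
    proof (rule integral_cong_AE)
      show "AE \<omega> in M. c powr I 0 \<omega> * d powr I 1 \<omega> = c ^ X a \<omega> * d ^ (X b \<omega> - X a \<omega>)"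
        using I0[OF that(1)] AE_space by eventually_elim (use that I1 in simp)
    qed (auto simp: I_def)
    \<comment> \<open>The law of the increment is obtained by dividing: it is the factor by which the
      generating function at \<open>b\<close> differs from the one at \<open>a\<close>.\<close>
    have E1: "expectation (\<lambda>\<omega>. y powr I 1 \<omega>) = exp ((\<mu> b - \<mu> a) * (y - 1))"
    proof -
      have "y ^ X a \<omega> * y ^ (X b \<omega> - X a \<omega>) = y ^ X b \<omega>" if "\<omega> \<in> space M" for \<omega>
        using mono[OF that ab] by (simp flip: power_add)
      then have "expectation (\<lambda>\<omega>. y ^ X a \<omega> * y ^ (X b \<omega> - X a \<omega>)) = expectation (\<lambda>\<omega>. y ^ X b \<omega>)"
        by (intro Bochner_Integration.integral_cong) auto
      then have "exp (\<mu> a * (y - 1)) * expectation (\<lambda>\<omega>. y powr I 1 \<omega>) = exp (\<mu> b * (y - 1))"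
        using prod[OF y y] joint[of y y] y by (simp add: E0 pgf)
      then have "expectation (\<lambda>\<omega>. y powr I 1 \<omega>) = exp (\<mu> b * (y - 1)) / exp (\<mu> a * (y - 1))"
        by (simp add: field_simps)
      then show ?thesis by (simp add: exp_diff[symmetric] algebra_simps)
    qed
    show ?thesis
      using prod[OF x y] joint[of x y] x y unfolding E1 by (simp add: E0 exp_add)
  qed
qed

section \<open>The cluster model conditional on its points\<close>

definition lower_grid :: "nat \<Rightarrow> real \<Rightarrow> real" where
  "lower_grid n v = of_int \<lfloor>real (Suc n) * v\<rfloor> / real (Suc n)"

lemma lower_grid_le: "lower_grid n v \<le> v"
  by (simp add: lower_grid_def field_simps del: of_nat_Suc)

lemma lower_grid_tendsto: "(\<lambda>n. lower_grid n v) \<longlonglongrightarrow> v"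
proof (rule LIM_zero_cancel, rule Lim_null_comparison)
  have "norm (lower_grid n v - v) \<le> inverse (real (Suc n))" for n
  proof -
    have "v - lower_grid n v \<le> 1 / real (Suc n)"
    proof -
      have "lower_grid n v * real (Suc n) = of_int \<lfloor>real (Suc n) * v\<rfloor>"
        by (simp add: lower_grid_def del: of_nat_Suc)
      then have "(v - lower_grid n v) * real (Suc n) \<le> 1"
        using real_of_int_floor_add_one_ge[of "real (Suc n) * v"]
        unfolding left_diff_distrib mult.commute[of v] by linarith
      then show ?thesis by (simp add: pos_le_divide_eq del: of_nat_Suc)
    qed
    then show ?thesis
      using lower_grid_le[of n v] by (simp add: divide_inverse del: of_nat_Suc)
  qed
  then show "\<forall>\<^sub>F n in sequentially. norm (lower_grid n v - v) \<le> inverse (real (Suc n))"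
    by simp
qed (rule LIMSEQ_inverse_real_of_nat)

lemma measurable_lower_grid [measurable]: "lower_grid n \<in> borel_measurable borel"
  unfolding lower_grid_def[abs_def] by measurable

text \<open>
  Rounding \<open>v\<close> down approaches \<open>t - v\<close> from the right, where an integer-valued right-continuous
  function is eventually constant.
\<close>
lemma right_continuous_lower_grid:
  fixes f :: "real \<Rightarrow> nat"
  assumes "continuous (at_right (t - v)) f"
  shows "\<forall>\<^sub>F n in sequentially. f (t - lower_grid n v) = f (t - v)"
proof -
  have "at (t - v) within {t - v..} = at_right (t - v)"
    unfolding at_within_def by (rule arg_cong[where f = "\<lambda>S. inf (nhds (t - v)) (principal S)"]) auto
  then have "continuous (at (t - v) within {t - v..}) f"
    using assms by simp
  moreover have "(\<lambda>n. t - lower_grid n v) \<longlonglongrightarrow> t - v"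
    by (intro tendsto_intros lower_grid_tendsto)
  ultimately have "(\<lambda>n. f (t - lower_grid n v)) \<longlonglongrightarrow> f (t - v)"
    by (intro continuous_within_tendsto_compose'[of "t - v" "{t - v..}" f]) (simp_all add: lower_grid_le)
  then show ?thesis
    by (simp add: nhds_discrete filterlim_principal)
qed

lemma measurable_point_count:
  assumes T: "\<And>j. T j \<in> borel_measurable M" and A [measurable]: "A \<in> sets borel"
  shows "point_count T A \<in> measurable M (count_space UNIV)"
proof -
  note T[measurable]
  have *: "T j \<omega> \<in> ereal ` A \<longleftrightarrow> \<bar>T j \<omega>\<bar> \<noteq> \<infinity> \<and> real_of_ereal (T j \<omega>) \<in> A" for j \<omega>
    by (cases "T j \<omega>") auto
  show ?thesis
    unfolding point_count_def[abs_def] * by measurable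
qed

locale poisson_cluster_model = prob_space P for P :: "'w measure" +
  fixes \<Lambda> :: "real measure" and \<mu> :: "real \<Rightarrow> real"
    and T :: "nat \<Rightarrow> 'w \<Rightarrow> ereal" and L :: "nat \<Rightarrow> real \<Rightarrow> 'w \<Rightarrow> nat"
  assumes points: "poisson_point_process P \<Lambda> T"
    and mean_value: "finite_mean_value_function \<mu>"
    and clusters: "iid_poisson_clusters P \<mu> L"
    and points_clusters_indep: "indep_elements P
           (PiM UNIV (\<lambda>_. borel)) (\<lambda>\<omega> j. T j \<omega>)
           (PiM UNIV (\<lambda>_. PiM UNIV (\<lambda>_. count_space UNIV))) (\<lambda>\<omega> j u. L j u \<omega>)"
begin

text \<open>
  \<open>R t\<close> is the mean of \<open>M(t)\<close> given the points: the random sum with the points themselves in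
  the place of the marks.
\<close>
abbreviation N :: "'w \<Rightarrow> nat" where "N \<equiv> point_count T {0..1}"
abbreviation R :: "real \<Rightarrow> 'w \<Rightarrow> real" where
  "R \<equiv> random_sum T \<mu> (\<lambda>j \<omega>. real_of_ereal (T j \<omega>))"

lemma T_measurable [measurable]: "T j \<in> borel_measurable P"
  using points by (auto simp: poisson_point_process_def)

lemma N_measurable [measurable]: "N \<in> measurable P (count_space UNIV)"
  by (rule measurable_point_count) auto

lemma \<mu>_mono: "mono \<mu>" and \<mu>_continuous: "continuous_on UNIV \<mu>" and \<mu>_zero: "t \<le> 0 \<Longrightarrow> \<mu> t = 0"
  using mean_value by (auto simp: finite_mean_value_function_def)

lemma \<mu>_measurable [measurable]: "\<mu> \<in> borel_measurable borel"
  using \<mu>_continuous by (rule borel_measurable_continuous_onI)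

lemma \<mu>_nonneg: "0 \<le> \<mu> t"
  using monoD[OF \<mu>_mono, of "min t 0" t] \<mu>_zero[of "min t 0"] by simp

lemma \<mu>_bounded: obtains c where "0 \<le> c" "\<And>t. \<mu> t \<le> c"
proof -
  obtain c where c: "(\<mu> \<longlongrightarrow> c) at_top"
    using mean_value by (auto simp: finite_mean_value_function_def)
  have "\<mu> t \<le> c" for t
    using c by (rule tendsto_lowerbound) (auto intro: eventually_at_top_linorderI monoD[OF \<mu>_mono])
  moreover from this[of 0] have "0 \<le> c" using \<mu>_zero[of 0] by simp
  ultimately show ?thesis using that by blast
qed

lemma L_counting: "poisson_counting_process P \<mu> (L j)"
  using clusters by (auto simp: iid_poisson_clusters_def)

lemma L_measurable [measurable]: "L j u \<in> measurable P (count_space UNIV)"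
  using L_counting[of j] by (auto simp: poisson_counting_process_def)

lemma L_mono: "\<omega> \<in> space P \<Longrightarrow> a \<le> b \<Longrightarrow> L j a \<omega> \<le> L j b \<omega>"
  using L_counting[of j] by (auto simp: poisson_counting_process_def mono_def)

lemma L_right_continuous: "\<omega> \<in> space P \<Longrightarrow> continuous (at_right a) (\<lambda>u. L j u \<omega>)"
  using L_counting[of j] by (auto simp: poisson_counting_process_def)

lemma R_measurable [measurable]: "R t \<in> borel_measurable P"
  unfolding random_sum_def[abs_def]
  by (rule measurable_compose_countable[where g = N]) measurable

lemma cluster_process_limit:
  assumes "\<omega> \<in> space P"
  shows "\<forall>\<^sub>F n in sequentially. (\<Sum>j<N \<omega>. L j (t - lower_grid n (real_of_ereal (T j \<omega>))) \<omega>)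
    = cluster_process T L t \<omega>"
proof -
  have "\<forall>\<^sub>F n in sequentially. \<forall>j\<in>{..<N \<omega>}.
      L j (t - lower_grid n (real_of_ereal (T j \<omega>))) \<omega> = L j (t - real_of_ereal (T j \<omega>)) \<omega>"
    using L_right_continuous[OF assms]
    by (intro eventually_ball_finite ballI right_continuous_lower_grid) auto
  then show ?thesis
    by eventually_elim (simp add: cluster_process_def)
qed

lemma measurable_at_grid_point [measurable]:
  "(\<lambda>\<omega>. L j (t - lower_grid n (real_of_ereal (T j \<omega>))) \<omega>) \<in> measurable P (count_space UNIV)"
  unfolding lower_grid_def by (rule measurable_compose_countable[where f = "\<lambda>i \<omega>. L j (t - of_int i / real (Suc n)) \<omega>"]) measurable

lemma cluster_process_measurable [measurable]:
  "cluster_process T L t \<in> measurable P (count_space UNIV)"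
proof -
  have "(\<lambda>\<omega>. real (cluster_process T L t \<omega>)) \<in> borel_measurable P"
  proof (rule borel_measurable_LIMSEQ_real)
    show "(\<lambda>n. real (\<Sum>j<N \<omega>. L j (t - lower_grid n (real_of_ereal (T j \<omega>))) \<omega>))
        \<longlonglongrightarrow> real (cluster_process T L t \<omega>)" if "\<omega> \<in> space P" for \<omega>
      using cluster_process_limit[OF that, of t]
      by (intro tendsto_eventually) (erule eventually_mono, simp only:)
    show "(\<lambda>\<omega>. real (\<Sum>j<N \<omega>. L j (t - lower_grid n (real_of_ereal (T j \<omega>))) \<omega>)) \<in> borel_measurable P" for n
      by (rule measurable_compose_countable[where g = N
            and f = "\<lambda>k \<omega>. real (\<Sum>j<k. L j (t - lower_grid n (real_of_ereal (T j \<omega>))) \<omega>)"]) measurable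
  qed
  then have "(\<lambda>\<omega>. nat \<lfloor>real (cluster_process T L t \<omega>)\<rfloor>) \<in> measurable P (count_space UNIV)"
    by measurable
  then show ?thesis by simp
qed

lemma cluster_process_mono:
  "\<omega> \<in> space P \<Longrightarrow> 0 \<le> s \<Longrightarrow> cluster_process T L t \<omega> \<le> cluster_process T L (t + s) \<omega>"
  unfolding cluster_process_def by (intro sum_mono L_mono) auto

text \<open>
  Conditioning on the points, after rounding them down. Once the points are fixed, the clusters
  contribute independent factors, each given by the generating function of its increments.
\<close>
lemma integral_over_grid:
  assumes s: "0 \<le> s" and x: "0 < x" "x \<le> 1" and y: "0 < y" "y \<le> 1"
  defines "v \<equiv> \<lambda>n j \<omega>. lower_grid n (real_of_ereal (T j \<omega>))"
  shows "expectation (\<lambda>\<omega>. \<Prod>j<N \<omega>. x ^ L j (t - v n j \<omega>) \<omega> *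
            y ^ (L j (t + s - v n j \<omega>) \<omega> - L j (t - v n j \<omega>) \<omega>))
       = expectation (\<lambda>\<omega>. \<Prod>j<N \<omega>. exp (\<mu> (t - v n j \<omega>) * (x - 1)
            + (\<mu> (t + s - v n j \<omega>) - \<mu> (t - v n j \<omega>)) * (y - 1)))"
proof -
  let ?C = "PiM UNIV (\<lambda>_ :: real. count_space (UNIV :: nat set))"
  let ?PT = "PiM UNIV (\<lambda>_ :: nat. borel :: ereal measure)" and ?PL = "PiM UNIV (\<lambda>_ :: nat. ?C)"
  define q :: "real \<Rightarrow> (real \<Rightarrow> nat) \<Rightarrow> real"
    where "q a l = x ^ l (t - a) * y ^ (l (t + s - a) - l (t - a))" for a l
  define G :: "real \<Rightarrow> real" where
    "G a = exp (\<mu> (t - a) * (x - 1) + (\<mu> (t + s - a) - \<mu> (t - a)) * (y - 1))" for a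
  define w :: "(nat \<Rightarrow> ereal) \<Rightarrow> nat \<Rightarrow> real" where "w \<tau> j = lower_grid n (real_of_ereal (\<tau> j))" for \<tau> j
  define c :: "(nat \<Rightarrow> ereal) \<Rightarrow> nat" where "c = point_count (\<lambda>j \<tau>. \<tau> j) {0..1}"
  define F where "F \<tau> l = (\<Prod>j<c \<tau>. q (w \<tau> j) (l j))" for \<tau> :: "nat \<Rightarrow> ereal" and l :: "nat \<Rightarrow> real \<Rightarrow> nat"
  have c_measurable [measurable]: "c \<in> measurable ?PT (count_space UNIV)"
    unfolding c_def by (rule measurable_point_count) auto
  have c_T: "c (\<lambda>j. T j \<omega>) = N \<omega>" for \<omega>
    by (simp add: c_def point_count_def)
  have w_T: "w (\<lambda>j. T j \<omega>) j = v n j \<omega>" for j \<omega>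
    by (simp add: w_def v_def)
  have [measurable]: "(\<lambda>l. l u) \<in> measurable ?C (count_space UNIV)" for u
    by (rule measurable_component_singleton) simp
  have q_measurable [measurable]: "q a \<in> borel_measurable ?C" for a
    unfolding q_def by measurable
  have q_bounds: "0 \<le> q a l" "q a l \<le> 1" for a l
    using x y by (auto simp: q_def intro!: mult_le_one power_le_one)
  have X1: "(\<lambda>\<omega> j. T j \<omega>) \<in> measurable P ?PT"
    by (rule measurable_PiM_single') (auto simp: T_measurable)
  have Lj: "(\<lambda>\<omega> u. L j u \<omega>) \<in> measurable P ?C" for j
    by (rule measurable_PiM_single') (auto simp: L_measurable)
  have X2: "(\<lambda>\<omega> j u. L j u \<omega>) \<in> measurable P ?PL"
    by (rule measurable_PiM_single') (auto simp: Lj space_PiM)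
  have F_meas: "case_prod F \<in> borel_measurable (?PT \<Otimes>\<^sub>M ?PL)"
  proof -
    (* The rounded points have countably many values, and evaluation at a fixed time
       is measurable. *)
    have factor: "(\<lambda>p. q (w (fst p) j) (snd p j)) \<in> borel_measurable (?PT \<Otimes>\<^sub>M ?PL)" for j
      unfolding w_def lower_grid_def
      by (rule measurable_compose_countable[where
            f = "\<lambda>i p. q (of_int i / real (Suc n)) (snd p j)"]) measurable
    have "(\<lambda>p. \<Prod>j<c (fst p). q (w (fst p) j) (snd p j)) \<in> borel_measurable (?PT \<Otimes>\<^sub>M ?PL)"
      by (rule measurable_compose_countable[where f = "\<lambda>k p. \<Prod>j<k. q (w (fst p) j) (snd p j)"])
         (intro borel_measurable_prod factor, measurable)
    then show ?thesis by (simp add: F_def case_prod_beta')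
  qed
  have F_bounds: "0 \<le> F \<tau> l" "F \<tau> l \<le> 1" for \<tau> l
    by (auto simp: F_def q_bounds intro!: prod_nonneg prod_le_1)
  have "integrable P (\<lambda>\<omega>. F (\<lambda>j. T j \<omega>) (\<lambda>j u. L j u \<omega>))"
    by (rule integrable_const_bound[where B = 1])
       (use measurable_compose[OF measurable_Pair[OF X1 X2] F_meas] F_bounds in auto)
  from indep_elements_integral[where F = F, OF X1 X2 points_clusters_indep F_meas this]
  have "expectation (\<lambda>\<omega>. F (\<lambda>j. T j \<omega>) (\<lambda>j u. L j u \<omega>))
      = expectation (\<lambda>\<omega>. expectation (\<lambda>\<omega>'. F (\<lambda>j. T j \<omega>) (\<lambda>j u. L j u \<omega>')))" .
  also have "\<dots> = expectation (\<lambda>\<omega>. \<Prod>j<N \<omega>. G (v n j \<omega>))"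
  proof (intro Bochner_Integration.integral_cong refl)
    fix \<omega>
    have "indep_vars (\<lambda>_. ?C) (\<lambda>j \<omega> u. L j u \<omega>) {..<N \<omega>}"
      using clusters by (auto simp: iid_poisson_clusters_def intro: indep_vars_subset)
    then have "indep_vars (\<lambda>_. borel) (\<lambda>j \<omega>'. q (v n j \<omega>) (\<lambda>u. L j u \<omega>')) {..<N \<omega>}"
      by (rule indep_vars_compose2) measurable
    moreover have "integrable P (\<lambda>\<omega>'. q (v n j \<omega>) (\<lambda>u. L j u \<omega>'))" for j
      by (rule integrable_const_bound[where B = 1])
         (use measurable_compose[OF Lj q_measurable] q_bounds in auto)
    ultimately have "expectation (\<lambda>\<omega>'. \<Prod>j<N \<omega>. q (v n j \<omega>) (\<lambda>u. L j u \<omega>'))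
        = (\<Prod>j<N \<omega>. expectation (\<lambda>\<omega>'. q (v n j \<omega>) (\<lambda>u. L j u \<omega>')))"
      by (intro indep_vars_lebesgue_integral) auto
    also have "\<dots> = (\<Prod>j<N \<omega>. G (v n j \<omega>))"
      unfolding q_def G_def using s x y
      by (intro prod.cong refl counting_process_pgf_increments[OF L_counting \<mu>_mono \<mu>_zero]) auto
    finally show "expectation (\<lambda>\<omega>'. F (\<lambda>j. T j \<omega>) (\<lambda>j u. L j u \<omega>')) = (\<Prod>j<N \<omega>. G (v n j \<omega>))"
      by (simp add: F_def c_T w_T)
  qed
  finally show ?thesis
    by (simp add: F_def c_T w_T q_def G_def)
qed

text \<open>
  Refinement of the grid in the previous lemma; all integrands lie in \<open>[0, 1]\<close>. The right-hand
  side is the generating function of two Poisson variables which are independent given their random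
  means.
\<close>
lemma cluster_pgf:
  assumes s: "0 \<le> s" and x: "0 < x" "x \<le> 1" and y: "0 < y" "y \<le> 1"
  shows "expectation (\<lambda>\<omega>. x ^ cluster_process T L t \<omega> *
            y ^ (cluster_process T L (t + s) \<omega> - cluster_process T L t \<omega>))
       = expectation (\<lambda>\<omega>. exp (R t \<omega> * (x - 1)) * exp ((R (t + s) \<omega> - R t \<omega>) * (y - 1)))"
proof -
  define v where "v n j \<omega> = lower_grid n (real_of_ereal (T j \<omega>))" for n j \<omega>
  define f where "f n \<omega> = (\<Prod>j<N \<omega>. x ^ L j (t - v n j \<omega>) \<omega> *
            y ^ (L j (t + s - v n j \<omega>) \<omega> - L j (t - v n j \<omega>) \<omega>))" for n \<omega>
  define g where "g n \<omega> = (\<Prod>j<N \<omega>. exp (\<mu> (t - v n j \<omega>) * (x - 1)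
            + (\<mu> (t + s - v n j \<omega>) - \<mu> (t - v n j \<omega>)) * (y - 1)))" for n \<omega>
  have [measurable]: "(\<lambda>\<omega>. L j (a - v n j \<omega>) \<omega>) \<in> measurable P (count_space UNIV)" for a n j
    unfolding v_def by measurable
  have [measurable]: "v n j \<in> borel_measurable P" for n j
    unfolding v_def by measurable
  have f_meas: "f n \<in> borel_measurable P" for n
    unfolding f_def by (rule measurable_compose_countable[where g = N]) measurable
  have g_meas: "g n \<in> borel_measurable P" for n
    unfolding g_def by (rule measurable_compose_countable[where g = N]) measurable
  have f_bound: "norm (f n \<omega>) \<le> 1" for n \<omega>
    unfolding f_def using x y
    by (auto simp: abs_prod intro!: prod_le_1 mult_le_one power_le_one)
  have g_bound: "norm (g n \<omega>) \<le> 1" for n \<omega>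
  proof -
    have "\<mu> (t - a) * (x - 1) + (\<mu> (t + s - a) - \<mu> (t - a)) * (y - 1) \<le> 0" for a
      using x y s monoD[OF \<mu>_mono, of "t - a" "t + s - a"] \<mu>_nonneg
      by (intro add_nonpos_nonpos mult_nonneg_nonpos) auto
    then show ?thesis
      unfolding g_def by (auto simp: abs_prod intro!: prod_le_1)
  qed
  have f_lim: "(\<lambda>n. f n \<omega>) \<longlonglongrightarrow> x ^ cluster_process T L t \<omega> *
      y ^ (cluster_process T L (t + s) \<omega> - cluster_process T L t \<omega>)" if "\<omega> \<in> space P" for \<omega>
  proof (rule tendsto_eventually)
    have f_eq: "f n \<omega> = x ^ (\<Sum>j<N \<omega>. L j (t - v n j \<omega>) \<omega>) *
        y ^ ((\<Sum>j<N \<omega>. L j (t + s - v n j \<omega>) \<omega>) - (\<Sum>j<N \<omega>. L j (t - v n j \<omega>) \<omega>))" for n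
      using s L_mono[OF that]
      by (simp add: f_def prod.distrib power_sum sum_subtractf_nat[symmetric])
    show "\<forall>\<^sub>F n in sequentially. f n \<omega> = x ^ cluster_process T L t \<omega> *
      y ^ (cluster_process T L (t + s) \<omega> - cluster_process T L t \<omega>)"
      using cluster_process_limit[OF that, of t] cluster_process_limit[OF that, of "t + s"]
      unfolding f_eq v_def by eventually_elim simp
  qed
  have g_lim: "(\<lambda>n. g n \<omega>) \<longlonglongrightarrow> exp (R t \<omega> * (x - 1)) * exp ((R (t + s) \<omega> - R t \<omega>) * (y - 1))" for \<omega>
  proof -
    let ?u = "\<lambda>j. real_of_ereal (T j \<omega>)"
    have \<mu>_lim: "(\<lambda>n. \<mu> (a - v n j \<omega>)) \<longlonglongrightarrow> \<mu> (a - ?u j)" for a j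
      unfolding v_def
      by (intro continuous_on_tendsto_compose[OF \<mu>_continuous] tendsto_intros lower_grid_tendsto) auto
    have "(\<lambda>n. g n \<omega>) \<longlonglongrightarrow> (\<Prod>j<N \<omega>. exp (\<mu> (t - ?u j) * (x - 1)
            + (\<mu> (t + s - ?u j) - \<mu> (t - ?u j)) * (y - 1)))"
      unfolding g_def by (intro tendsto_intros \<mu>_lim)
    also have "(\<Prod>j<N \<omega>. exp (\<mu> (t - ?u j) * (x - 1) + (\<mu> (t + s - ?u j) - \<mu> (t - ?u j)) * (y - 1)))
        = exp (R t \<omega> * (x - 1) + (R (t + s) \<omega> - R t \<omega>) * (y - 1))"
      by (simp add: random_sum_def exp_sum[symmetric] sum.distrib sum_subtractf sum_distrib_right[symmetric])
    finally show ?thesis by (simp add: exp_add)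
  qed
  have "(\<lambda>n. expectation (f n)) \<longlonglongrightarrow> expectation (\<lambda>\<omega>. x ^ cluster_process T L t \<omega> *
      y ^ (cluster_process T L (t + s) \<omega> - cluster_process T L t \<omega>))"
    by (rule integral_dominated_convergence[where w = "\<lambda>_. 1"])
       (use f_lim f_bound f_meas in auto)
  moreover have "(\<lambda>n. expectation (g n)) \<longlonglongrightarrow>
      expectation (\<lambda>\<omega>. exp (R t \<omega> * (x - 1)) * exp ((R (t + s) \<omega> - R t \<omega>) * (y - 1)))"
    by (rule integral_dominated_convergence[where w = "\<lambda>_. 1"])
       (use g_lim g_bound g_meas in auto)
  moreover have "expectation (f n) = expectation (g n)" for n
    unfolding f_def g_def v_def by (rule integral_over_grid[OF s x y])
  ultimately show ?thesis
    using LIMSEQ_unique by simp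
qed

end

section \<open>Laplace functionals of the points and of i.i.d. marks\<close>

lemma finite_initial_segment:
  fixes S :: "nat set"
  assumes "finite S" and "\<And>i j. i \<le> j \<Longrightarrow> j \<in> S \<Longrightarrow> i \<in> S"
  shows "S = {..<card S}"
proof (cases "S = {}")
  case False
  have "Max S \<in> S"
    using assms(1) False by simp
  then have "S = {..Max S}"
    using assms(1) assms(2)[OF _ \<open>Max S \<in> S\<close>] by auto
  then show ?thesis
    by (metis card_atMost lessThan_Suc_atMost)
qed simp

lemma has_bochner_integral_uniform_measure:
  fixes f :: "'a \<Rightarrow> real"
  assumes A [measurable]: "A \<in> sets M" and pos: "0 < emeasure M A" and fin: "emeasure M A < \<infinity>"
    and f: "has_bochner_integral M (\<lambda>x. f x * indicator A x) I" and [measurable]: "f \<in> borel_measurable M"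
  shows "has_bochner_integral (uniform_measure M A) f (I / measure M A)"
proof -
  have m: "emeasure M A = ennreal (measure M A)" "0 < measure M A"
  proof -
    show eq: "emeasure M A = ennreal (measure M A)"
      using fin by (intro emeasure_eq_ennreal_measure) auto
    show "0 < measure M A"
      using pos unfolding eq by simp
  qed
  have eq: "uniform_measure M A = density M (\<lambda>x. ennreal (indicator A x / measure M A))"
    unfolding uniform_measure_def
  proof (intro density_cong AE_I2)
    show "indicator A x / emeasure M A = ennreal (indicator A x / measure M A)" for x
      using m divide_ennreal[of 1 "measure M A"] by (cases "x \<in> A") simp_all
  qed measurable
  have "has_bochner_integral M (\<lambda>x. (indicator A x / measure M A) *\<^sub>R f x) (I / measure M A)"
    using has_bochner_integral_divide[OF f, of "measure M A"] m by (simp add: mult.commute)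
  then show ?thesis
    unfolding eq has_bochner_integral_iff
    using m by (auto simp: integrable_density integral_density)
qed

context prob_space begin

lemma point_count_pgf:
  assumes pp: "poisson_point_process M \<Lambda> T" and A: "A \<in> sets borel" "bounded A" and x: "0 \<le> x"
  shows "has_bochner_integral M (\<lambda>\<omega>. x ^ point_count T A \<omega>) (exp (measure \<Lambda> A * (x - 1)))"
proof (rule poisson_pgf[OF _ _ x])
  show "point_count T A \<in> measurable M (count_space UNIV)"
    using pp A by (intro measurable_point_count) (simp_all only: poisson_point_process_def)
  show "prob {\<omega>\<in>space M. point_count T A \<omega> = k} = poisson_weight (measure \<Lambda> A) k" for k
    using pp A unfolding poisson_point_process_def poisson_weight_def by blast
qed

text \<open>
  Almost surely the points are positive and increasing, so those in the unit interval form an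
  initial segment. This turns sums over the first \<open>N(1)\<close> indices into sums over the points lying in
  \<open>[0, 1]\<close>.
\<close>
lemma points_in_unit_interval:
  assumes pp: "poisson_point_process M \<Lambda> T"
  shows "AE \<omega> in M. {j. T j \<omega> \<in> ereal ` {0..1}} = {..<point_count T {0..1} \<omega>}"
proof -
  have "AE \<omega> in M. 0 < T 0 \<omega> \<and>
        (\<forall>j. T j \<omega> < T (Suc j) \<omega> \<or> T j \<omega> = \<infinity> \<and> T (Suc j) \<omega> = \<infinity>) \<and>
        (\<forall>x::real. finite {j. T j \<omega> \<le> ereal x})"
    using pp by (auto simp: poisson_point_process_def)
  then show ?thesis
  proof eventually_elim
    case (elim \<omega>)
    then have "T j \<omega> \<le> T (Suc j) \<omega>" for j
      by (metis less_imp_le order_refl)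
    then have T_le: "T i \<omega> \<le> T j \<omega>" if "i \<le> j" for i j
      using that by (rule lift_Suc_mono_le)
    have unit: "e \<in> ereal ` {0..1} \<longleftrightarrow> 0 \<le> e \<and> e \<le> 1" for e :: ereal
      by (cases e) auto
    have "finite {j. T j \<omega> \<le> ereal 1}"
      using elim by blast
    then have fin: "finite {j. T j \<omega> \<in> ereal ` {0..1}}"
      by (rule finite_subset[rotated]) (auto simp: unit one_ereal_def)
    have down: "T i \<omega> \<in> ereal ` {0..1}" if "i \<le> j" "T j \<omega> \<in> ereal ` {0..1}" for i j
      using elim T_le[of 0 i] T_le[OF that(1)] that(2) unfolding unit
      by (auto intro: order_trans less_imp_le)
    show ?case
      unfolding point_count_def by (rule finite_initial_segment[OF fin]) (use down in blast)
  qed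
qed

text \<open>
  A function of the rounded points is constant on each of finitely many cells, so the sum is
  a linear combination of the numbers of points in the cells. These are independent Poisson variables,
  and the product of their generating functions is the exponential of an integral.
\<close>
lemma point_process_laplace_on_grid:
  fixes h :: "real \<Rightarrow> real"
  assumes pp: "poisson_point_process M \<Lambda> T"
  shows "expectation (\<lambda>\<omega>. exp (\<Sum>j<point_count T {0..1} \<omega>. h (lower_grid n (real_of_ereal (T j \<omega>)))))
    = exp (\<integral>x. (exp (h (lower_grid n x)) - 1) * indicator {0..1} x \<partial>\<Lambda>)"
proof -
  define cell where "cell i = {x\<in>{0..1}. nat \<lfloor>real (Suc n) * x\<rfloor> = i}" for i
  have sets_\<Lambda> [simp, measurable_cong]: "sets \<Lambda> = sets borel"
    using pp by (auto simp: poisson_point_process_def)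
  have cell_sets [measurable]: "cell i \<in> sets borel" for i
    unfolding cell_def by measurable
  have cell_bounded: "bounded (cell i)" for i
    by (rule bounded_subset[of "{0..1}"]) (auto simp: cell_def)
  have cell_disjoint: "disjoint_family cell"
    by (auto simp: disjoint_family_on_def cell_def)
  have \<Lambda>_finite: "emeasure \<Lambda> A < \<infinity>" if "A \<subseteq> {0..1}" "A \<in> sets borel" for A
    using emeasure_mono[OF that(1), of \<Lambda>] pp by (auto simp: poisson_point_process_def intro: le_less_trans)
  have grid: "lower_grid n x = real i / real (Suc n)" "i \<le> Suc n" if "x \<in> cell i" for x i
  proof -
    have x: "0 \<le> x" "x \<le> 1" and i: "i = nat \<lfloor>real (Suc n) * x\<rfloor>"
      using that by (auto simp: cell_def)
    have "0 \<le> real (Suc n) * x" "real (Suc n) * x \<le> real (Suc n)"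
      using x by (auto intro: mult_left_le)
    moreover from this have "real (Suc n) * x < real (Suc n) + 1" by linarith
    ultimately show "lower_grid n x = real i / real (Suc n)" "i \<le> Suc n"
      unfolding i lower_grid_def by (auto simp: of_nat_nat nat_le_iff floor_le_iff simp del: of_nat_Suc)
  qed
  define g where "g i = h (real i / real (Suc n))" for i
  have sum_cells: "AE \<omega> in M. (\<Sum>j<point_count T {0..1} \<omega>. h (lower_grid n (real_of_ereal (T j \<omega>))))
      = (\<Sum>i\<le>Suc n. g i * real (point_count T (cell i) \<omega>))"
    using points_in_unit_interval[OF pp]
  proof eventually_elim
    case (elim \<omega>)
    let ?S = "{j. T j \<omega> \<in> ereal ` {0..1}}" and ?u = "\<lambda>j. real_of_ereal (T j \<omega>)"
    let ?i = "\<lambda>j. nat \<lfloor>real (Suc n) * ?u j\<rfloor>"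
    have fin: "finite ?S" unfolding elim by simp
    have in_cell: "?u j \<in> cell (?i j)" if "j \<in> ?S" for j
      using that by (auto simp: cell_def)
    have "(\<Sum>j\<in>?S. h (lower_grid n (?u j))) = (\<Sum>i\<le>Suc n. \<Sum>j\<in>{j\<in>?S. ?i j = i}. h (lower_grid n (?u j)))"
    proof (rule sum.group[symmetric])
      show "?i ` ?S \<subseteq> {..Suc n}"
        using grid(2)[OF in_cell] by (intro image_subsetI) (simp only: atMost_iff)
    qed (use fin in simp_all)
    also have "\<dots> = (\<Sum>i\<le>Suc n. g i * real (point_count T (cell i) \<omega>))"
    proof (rule sum.cong[OF refl])
      fix i
      have "(\<Sum>j\<in>{j\<in>?S. ?i j = i}. h (lower_grid n (?u j))) = (\<Sum>j\<in>{j\<in>?S. ?i j = i}. g i)"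
        using grid(1)[OF in_cell] by (intro sum.cong) (auto simp: g_def)
      moreover have "{j\<in>?S. ?i j = i} = {j. T j \<omega> \<in> ereal ` cell i}"
        by (auto simp: cell_def)
      ultimately show "(\<Sum>j\<in>{j\<in>?S. ?i j = i}. h (lower_grid n (?u j))) = g i * real (point_count T (cell i) \<omega>)"
        by (simp add: point_count_def)
    qed
    finally show ?case unfolding elim .
  qed
  have "expectation (\<lambda>\<omega>. exp (\<Sum>j<point_count T {0..1} \<omega>. h (lower_grid n (real_of_ereal (T j \<omega>)))))
     = expectation (\<lambda>\<omega>. \<Prod>i\<le>Suc n. exp (g i) ^ point_count T (cell i) \<omega>)"
  proof (rule integral_cong_AE)
    have T [measurable]: "T j \<in> borel_measurable M" for j
      using pp by (auto simp: poisson_point_process_def)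
    have [measurable]: "point_count T A \<in> measurable M (count_space UNIV)" if "A \<in> sets borel" for A
      using that by (intro measurable_point_count) auto
    show "(\<lambda>\<omega>. \<Prod>i\<le>Suc n. exp (g i) ^ point_count T (cell i) \<omega>) \<in> borel_measurable M"
      by measurable
    have [measurable]: "(\<lambda>\<omega>. h (lower_grid n (real_of_ereal (T j \<omega>)))) \<in> borel_measurable M" for j
      unfolding lower_grid_def
      by (rule measurable_compose_countable[where f = "\<lambda>i \<omega>. h (of_int i / real (Suc n))"]) measurable
    show "(\<lambda>\<omega>. exp (\<Sum>j<point_count T {0..1} \<omega>. h (lower_grid n (real_of_ereal (T j \<omega>))))) \<in> borel_measurable M"
      by (rule measurable_compose_countable[where g = "point_count T {0..1}"]) measurable
    show "AE \<omega> in M. exp (\<Sum>j<point_count T {0..1} \<omega>. h (lower_grid n (real_of_ereal (T j \<omega>))))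
        = (\<Prod>i\<le>Suc n. exp (g i) ^ point_count T (cell i) \<omega>)"
      using sum_cells by eventually_elim (simp add: exp_sum exp_of_nat2_mult del: sum.atMost_Suc prod.atMost_Suc)
  qed
  also have "\<dots> = (\<Prod>i\<le>Suc n. expectation (\<lambda>\<omega>. exp (g i) ^ point_count T (cell i) \<omega>))"
  proof (rule indep_vars_lebesgue_integral)
    have "indep_vars (\<lambda>_. count_space UNIV) (\<lambda>i. point_count T (cell i)) UNIV"
      (* the last conjunct of the definition: independence over disjoint sets *)
      using pp[unfolded poisson_point_process_def, THEN conjunct2, THEN conjunct2, THEN conjunct2,
          THEN conjunct2, THEN conjunct2, THEN conjunct2] cell_disjoint cell_bounded cell_sets
      by (elim allE[of _ cell]) simp
    then have "indep_vars (\<lambda>_. count_space UNIV) (\<lambda>i. point_count T (cell i)) {..Suc n}"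
      by (rule indep_vars_subset) simp
    then show "indep_vars (\<lambda>_. borel) (\<lambda>i \<omega>. exp (g i) ^ point_count T (cell i) \<omega>) {..Suc n}"
      by (rule indep_vars_compose2) simp
    show "integrable M (\<lambda>\<omega>. exp (g i) ^ point_count T (cell i) \<omega>)" for i
      using point_count_pgf[OF pp cell_sets cell_bounded] by (auto simp: has_bochner_integral_iff)
  qed simp
  also have "\<dots> = (\<Prod>i\<le>Suc n. exp (measure \<Lambda> (cell i) * (exp (g i) - 1)))"
    using point_count_pgf[OF pp cell_sets cell_bounded] by (simp add: has_bochner_integral_iff)
  also have "\<dots> = exp (\<Sum>i\<le>Suc n. (exp (g i) - 1) * measure \<Lambda> (cell i))"
    by (simp only: exp_sum finite_atMost mult.commute)
  also have "(\<Sum>i\<le>Suc n. (exp (g i) - 1) * measure \<Lambda> (cell i))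
      = (\<integral>x. (\<Sum>i\<le>Suc n. (exp (g i) - 1) * indicator (cell i) x) \<partial>\<Lambda>)"
  proof -
    have "emeasure \<Lambda> (cell i) < \<infinity>" for i
      by (rule \<Lambda>_finite) (auto simp: cell_def)
    then show ?thesis
      by (subst Bochner_Integration.integral_sum) simp_all
  qed
  also have "\<dots> = (\<integral>x. (exp (h (lower_grid n x)) - 1) * indicator {0..1} x \<partial>\<Lambda>)"
  proof (intro Bochner_Integration.integral_cong refl)
    fix x
    show "(\<Sum>i\<le>Suc n. (exp (g i) - 1) * indicator (cell i) x) = (exp (h (lower_grid n x)) - 1) * indicator {0..1} x"
    proof (cases "x \<in> {0..1}")
      case True
      define k where "k = nat \<lfloor>real (Suc n) * x\<rfloor>"
      have x: "x \<in> cell k" using True by (simp add: cell_def k_def)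
      have "(\<Sum>i\<le>Suc n. (exp (g i) - 1) * indicator (cell i) x)
          = (\<Sum>i\<in>{k}. (exp (g i) - 1) * indicator (cell i) x)"
        using grid(2)[OF x] by (intro sum.mono_neutral_right) (auto simp: cell_def k_def)
      also have "\<dots> = exp (g k) - 1" using x by simp
      finally show ?thesis
        using True grid(1)[OF x] by (simp add: g_def)
    next
      case False
      then show ?thesis by (intro sum.neutral[THEN trans]) (auto simp: cell_def)
    qed
  qed
  finally show ?thesis .
qed

text \<open>
  Refinement of the grid in the previous lemma, where \<open>h\<close> is continuous at every point. The
  integrands are dominated by \<open>exp c\<close> raised to the number of points, which is integrable because a Poisson variable has exponential moments of all orders.
\<close>
lemma point_process_laplace_functional:
  fixes h :: "real \<Rightarrow> real"
  assumes pp: "poisson_point_process M \<Lambda> T"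
    and h: "continuous_on UNIV h" and c: "\<And>x. \<bar>h x\<bar> \<le> c"
  shows "expectation (\<lambda>\<omega>. exp (\<Sum>j<point_count T {0..1} \<omega>. h (real_of_ereal (T j \<omega>))))
    = exp (\<integral>x. (exp (h x) - 1) * indicator {0..1} x \<partial>\<Lambda>)"
proof -
  let ?N = "point_count T {0..1}" and ?u = "\<lambda>j \<omega>. real_of_ereal (T j \<omega>)"
  have [simp, measurable_cong]: "sets \<Lambda> = sets borel"
    using pp by (auto simp: poisson_point_process_def)
  have \<Lambda>_finite: "emeasure \<Lambda> {0..1} < \<infinity>"
    using pp by (auto simp: poisson_point_process_def)
  have T [measurable]: "T j \<in> borel_measurable M" for j
    using pp by (auto simp: poisson_point_process_def)
  have [measurable]: "?N \<in> measurable M (count_space UNIV)"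
    by (intro measurable_point_count) auto
  have h_measurable [measurable]: "h \<in> borel_measurable borel"
    using h by (rule borel_measurable_continuous_onI)
  have h_lim: "(\<lambda>n. h (lower_grid n x)) \<longlonglongrightarrow> h x" for x
    by (intro continuous_on_tendsto_compose[OF h] lower_grid_tendsto) auto
  have c': "h x \<le> c" for x using c[of x] by simp
  have "(\<lambda>n. expectation (\<lambda>\<omega>. exp (\<Sum>j<?N \<omega>. h (lower_grid n (?u j \<omega>)))))
      \<longlonglongrightarrow> expectation (\<lambda>\<omega>. exp (\<Sum>j<?N \<omega>. h (?u j \<omega>)))"
  proof (rule integral_dominated_convergence[where w = "\<lambda>\<omega>. exp c ^ ?N \<omega>"])
    show "(\<lambda>\<omega>. exp (\<Sum>j<?N \<omega>. h (?u j \<omega>))) \<in> borel_measurable M"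
      "(\<lambda>\<omega>. exp (\<Sum>j<?N \<omega>. h (lower_grid n (?u j \<omega>)))) \<in> borel_measurable M" for n
      by (rule measurable_compose_countable[where g = ?N]; measurable)+
    show "integrable M (\<lambda>\<omega>. exp c ^ ?N \<omega>)"
      using point_count_pgf[OF pp, of "{0..1}" "exp c"] by (simp add: has_bochner_integral_iff)
    show "AE \<omega> in M. (\<lambda>n. exp (\<Sum>j<?N \<omega>. h (lower_grid n (?u j \<omega>)))) \<longlonglongrightarrow> exp (\<Sum>j<?N \<omega>. h (?u j \<omega>))"
      by (intro AE_I2 tendsto_intros h_lim)
    show "AE \<omega> in M. norm (exp (\<Sum>j<?N \<omega>. h (lower_grid n (?u j \<omega>)))) \<le> exp c ^ ?N \<omega>" for n
      using sum_bounded_above[of "{..<?N _}", OF c'] by (intro AE_I2) (simp add: exp_of_nat_mult[symmetric])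
  qed
  moreover have "(\<lambda>n. exp (\<integral>x. (exp (h (lower_grid n x)) - 1) * indicator {0..1} x \<partial>\<Lambda>))
      \<longlonglongrightarrow> exp (\<integral>x. (exp (h x) - 1) * indicator {0..1} x \<partial>\<Lambda>)"
  proof (intro tendsto_exp integral_dominated_convergence[where w = "\<lambda>x. (exp c + 1) * indicator {0..1} x"])
    show "integrable \<Lambda> (\<lambda>x. (exp c + 1) * indicator {0..1} x)"
      using \<Lambda>_finite by simp
    show "AE x in \<Lambda>. (\<lambda>n. (exp (h (lower_grid n x)) - 1) * indicator {0..1} x)
        \<longlonglongrightarrow> (exp (h x) - 1) * indicator {0..1} x"
      by (intro AE_I2 tendsto_intros h_lim)
    have "\<bar>exp (h x) - 1\<bar> \<le> exp c + 1" for x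
    proof -
      have "0 < exp (h x)" "exp (h x) \<le> exp c" using c'[of x] by simp_all
      then show ?thesis by linarith
    qed
    then show "AE x in \<Lambda>. norm ((exp (h (lower_grid n x)) - 1) * indicator {0..1} x)
        \<le> (exp c + 1) * indicator {0..1} x" for n
      by (intro AE_I2) (auto simp: indicator_def)
  qed measurable
  ultimately show ?thesis
    unfolding point_process_laplace_on_grid[OF pp] by (rule LIMSEQ_unique)
qed

text \<open>
  Given the number of points, the marks contribute a power of the mean \<open>\<gamma>\<close> of \<open>exp \<circ> h\<close> under the normalized
  mean measure; the Poisson generating function at \<open>\<gamma>\<close> then cancels the normalization. The
  value is the same as for the points themselves.
\<close>
lemma iid_marks_laplace_functional:
  fixes h :: "real \<Rightarrow> real"
  assumes pp: "poisson_point_process M \<Lambda> T" and pos: "0 < emeasure \<Lambda> {0..1}"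
    and V: "indep_vars (\<lambda>_. borel) V UNIV" "\<And>j. distr M borel (V j) = uniform_measure \<Lambda> {0..1}"
    and TV: "indep_elements M (PiM UNIV (\<lambda>_. borel)) (\<lambda>\<omega> j. T j \<omega>) (PiM UNIV (\<lambda>_. borel)) (\<lambda>\<omega> j. V j \<omega>)"
    and h [measurable]: "h \<in> borel_measurable borel" and c: "\<And>x. \<bar>h x\<bar> \<le> c"
  shows "expectation (\<lambda>\<omega>. exp (\<Sum>j<point_count T {0..1} \<omega>. h (V j \<omega>)))
    = exp (\<integral>x. (exp (h x) - 1) * indicator {0..1} x \<partial>\<Lambda>)"
proof -
  let ?N = "point_count T {0..1}" and ?l = "measure \<Lambda> {0..1}"
  let ?PT = "PiM UNIV (\<lambda>_ :: nat. borel :: ereal measure)" and ?PV = "PiM UNIV (\<lambda>_ :: nat. borel :: real measure)"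
  have sets_\<Lambda> [simp, measurable_cong]: "sets \<Lambda> = sets borel"
    using pp by (auto simp: poisson_point_process_def)
  have \<Lambda>_finite: "emeasure \<Lambda> {0..1} < \<infinity>"
    using pp by (auto simp: poisson_point_process_def)
  have T [measurable]: "T j \<in> borel_measurable M" for j
    using pp by (auto simp: poisson_point_process_def)
  have N_measurable [measurable]: "?N \<in> measurable M (count_space UNIV)"
    by (intro measurable_point_count) auto
  have V_measurable [measurable]: "V j \<in> borel_measurable M" for j
    using V(1) by (auto simp: indep_vars_def)
  have l: "0 < ?l"
  proof -
    have "emeasure \<Lambda> {0..1} = ennreal ?l"
      using \<Lambda>_finite by (intro emeasure_eq_ennreal_measure) auto
    then show ?thesis using pos by simp
  qed
  have c': "h x \<le> c" for x using c[of x] by simp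
  have exp_h: "integrable \<Lambda> (\<lambda>x. exp (h x) * indicator {0..1} x)"
  proof (rule Bochner_Integration.integrable_bound[where f = "\<lambda>x. exp c * indicator {0..1} x"])
    show "integrable \<Lambda> (\<lambda>x. exp c * indicator {0..1} x)" using \<Lambda>_finite by simp
  qed (auto intro!: AE_I2 simp: c' indicator_def)
  define \<gamma> where "\<gamma> = (\<integral>x. exp (h x) * indicator {0..1} x \<partial>\<Lambda>) / ?l"
  have \<gamma>_nonneg: "0 \<le> \<gamma>"
    unfolding \<gamma>_def by (intro divide_nonneg_nonneg integral_nonneg_AE) auto
  have mark: "has_bochner_integral M (\<lambda>\<omega>. exp (h (V j \<omega>))) \<gamma>" for j
  proof -
    have "has_bochner_integral (uniform_measure \<Lambda> {0..1}) (\<lambda>x. exp (h x)) \<gamma>"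
      unfolding \<gamma>_def using exp_h pos \<Lambda>_finite
      by (intro has_bochner_integral_uniform_measure) (auto simp: has_bochner_integral_iff)
    then have "has_bochner_integral (distr M borel (V j)) (\<lambda>x. exp (h x)) \<gamma>"
      by (simp add: V(2))
    then show ?thesis
      by (simp add: has_bochner_integral_iff integrable_distr_eq integral_distr)
  qed
  define k :: "(nat \<Rightarrow> ereal) \<Rightarrow> nat" where "k = point_count (\<lambda>j \<tau>. \<tau> j) {0..1}"
  have [measurable]: "k \<in> measurable ?PT (count_space UNIV)"
    unfolding k_def by (rule measurable_point_count) auto
  have k_T: "k (\<lambda>j. T j \<omega>) = ?N \<omega>" for \<omega>
    by (simp add: k_def point_count_def)
  define F where "F \<tau> v = (\<Prod>j<k \<tau>. exp (h (v j)))" for \<tau> and v :: "nat \<Rightarrow> real"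
  have X1: "(\<lambda>\<omega> j. T j \<omega>) \<in> measurable M ?PT"
    by (rule measurable_PiM_single') (auto simp: T)
  have X2: "(\<lambda>\<omega> j. V j \<omega>) \<in> measurable M ?PV"
    by (rule measurable_PiM_single') (auto simp: V_measurable)
  have F_meas: "case_prod F \<in> borel_measurable (?PT \<Otimes>\<^sub>M ?PV)"
  proof -
    have "(\<lambda>p. \<Prod>j<k (fst p). exp (h (snd p j))) \<in> borel_measurable (?PT \<Otimes>\<^sub>M ?PV)"
      by (rule measurable_compose_countable[where f = "\<lambda>k p. \<Prod>j<k. exp (h (snd p j))"]) measurable
    then show ?thesis by (simp add: F_def case_prod_beta')
  qed
  have "integrable M (\<lambda>\<omega>. F (\<lambda>j. T j \<omega>) (\<lambda>j. V j \<omega>))"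
  proof (rule Bochner_Integration.integrable_bound[where f = "\<lambda>\<omega>. exp c ^ ?N \<omega>"])
    show "integrable M (\<lambda>\<omega>. exp c ^ ?N \<omega>)"
      using point_count_pgf[OF pp, of "{0..1}" "exp c"] by (simp add: has_bochner_integral_iff)
    show "(\<lambda>\<omega>. F (\<lambda>j. T j \<omega>) (\<lambda>j. V j \<omega>)) \<in> borel_measurable M"
      using measurable_compose[OF measurable_Pair[OF X1 X2] F_meas] by simp
    show "AE \<omega> in M. norm (F (\<lambda>j. T j \<omega>) (\<lambda>j. V j \<omega>)) \<le> norm (exp c ^ ?N \<omega>)"
      using sum_bounded_above[of "{..<?N _}", OF c']
      by (intro AE_I2) (simp add: F_def k_T exp_of_nat_mult[symmetric] exp_sum[symmetric])
  qed
  from indep_elements_integral[where F = F, OF X1 X2 TV F_meas this]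
  have "expectation (\<lambda>\<omega>. F (\<lambda>j. T j \<omega>) (\<lambda>j. V j \<omega>))
     = expectation (\<lambda>\<omega>. expectation (\<lambda>\<omega>'. F (\<lambda>j. T j \<omega>) (\<lambda>j. V j \<omega>')))" .
  also have "\<dots> = expectation (\<lambda>\<omega>. \<gamma> ^ ?N \<omega>)"
  proof (intro Bochner_Integration.integral_cong refl)
    fix \<omega>
    have "indep_vars (\<lambda>_. borel) (\<lambda>j \<omega>'. exp (h (V j \<omega>'))) {..<?N \<omega>}"
      using indep_vars_subset[OF V(1) subset_UNIV] by (rule indep_vars_compose2) measurable
    then have "expectation (\<lambda>\<omega>'. \<Prod>j<?N \<omega>. exp (h (V j \<omega>'))) = (\<Prod>j<?N \<omega>. expectation (\<lambda>\<omega>'. exp (h (V j \<omega>'))))"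
      using mark by (intro indep_vars_lebesgue_integral) (auto simp: has_bochner_integral_iff)
    also have "\<dots> = \<gamma> ^ ?N \<omega>"
      using mark by (simp add: has_bochner_integral_iff)
    finally show "expectation (\<lambda>\<omega>'. F (\<lambda>j. T j \<omega>) (\<lambda>j. V j \<omega>')) = \<gamma> ^ ?N \<omega>"
      by (simp add: F_def k_T)
  qed
  also have "\<dots> = exp (?l * (\<gamma> - 1))"
    using point_count_pgf[OF pp, of "{0..1}" \<gamma>] \<gamma>_nonneg by (simp add: has_bochner_integral_iff)
  also have "?l * (\<gamma> - 1) = (\<integral>x. (exp (h x) - 1) * indicator {0..1} x \<partial>\<Lambda>)"
    using l exp_h \<Lambda>_finite by (simp add: \<gamma>_def field_simps left_diff_distrib)
  finally show ?thesis
    by (simp add: F_def k_T exp_sum)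
qed

end

section \<open>Derivatives of Laplace transforms\<close>

lemma abs_exp_diff_quotient_le:
  fixes d y :: real
  assumes "d \<noteq> 0" "\<bar>d\<bar> \<le> 1"
  shows "\<bar>(exp (d * y) - 1) / d\<bar> \<le> \<bar>y\<bar> * exp \<bar>y\<bar>"
proof -
  have "\<bar>exp z - 1\<bar> \<le> \<bar>z\<bar> * exp \<bar>z\<bar>" for z :: real
  proof (cases "0 \<le> z")
    case True
    have "1 - z \<le> exp (- z)" using exp_ge_add_one_self[of "- z"] by simp
    then have "(1 - z) * exp z \<le> exp (- z) * exp z"
      by (rule mult_right_mono) simp
    then show ?thesis using True by (simp add: mult_exp_exp algebra_simps)
  next
    case False
    then have "\<bar>exp z - 1\<bar> = 1 - exp z" by simp
    also have "\<dots> \<le> \<bar>z\<bar>" using exp_ge_add_one_self[of z] by linarith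
    also have "\<dots> = \<bar>z\<bar> * 1" by simp
    also have "\<dots> \<le> \<bar>z\<bar> * exp \<bar>z\<bar>" by (intro mult_left_mono) auto
    finally show ?thesis .
  qed
  from this[of "d * y"] have "\<bar>exp (d * y) - 1\<bar> \<le> \<bar>d\<bar> * (\<bar>y\<bar> * exp (\<bar>d\<bar> * \<bar>y\<bar>))"
    by (simp add: abs_mult)
  also have "\<dots> \<le> \<bar>d\<bar> * (\<bar>y\<bar> * exp \<bar>y\<bar>)"
    using assms by (intro mult_left_mono) (auto intro: mult_left_le_one_le)
  finally show ?thesis
    using assms by (simp add: field_simps)
qed

text \<open>
  Bounds the difference quotients of \<open>exp (z * Y)\<close>, and powers of \<open>Y\<close>, by exponential moments
  of \<open>Y\<close> of both signs.
\<close>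
lemma abs_mult_exp_le:
  fixes y :: real
  shows "\<bar>y\<bar> * exp (k * \<bar>y\<bar>) \<le> exp ((k + 1) * y) + exp (- ((k + 1) * y))"
proof -
  have "\<bar>y\<bar> \<le> exp \<bar>y\<bar>" using exp_ge_add_one_self[of "\<bar>y\<bar>"] by linarith
  then have "\<bar>y\<bar> * exp (k * \<bar>y\<bar>) \<le> exp \<bar>y\<bar> * exp (k * \<bar>y\<bar>)"
    by (intro mult_right_mono) auto
  also have "\<dots> = exp ((k + 1) * \<bar>y\<bar>)" by (simp add: mult_exp_exp algebra_simps)
  also have "\<dots> \<le> exp ((k + 1) * y) + exp (- ((k + 1) * y))"
    by (cases "0 \<le> y") simp_all
  finally show ?thesis .
qed

lemma integrable_exp_weight_mult:
  fixes W Y :: "'a \<Rightarrow> real"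
  assumes int: "\<And>a. integrable M (\<lambda>\<omega>. W \<omega> * exp (a * Y \<omega>))"
    and [measurable]: "W \<in> borel_measurable M" "Y \<in> borel_measurable M"
  shows "integrable M (\<lambda>\<omega>. Y \<omega> * W \<omega> * exp (a * Y \<omega>))"
proof (rule Bochner_Integration.integrable_bound)
  show "integrable M (\<lambda>\<omega>. \<bar>W \<omega> * exp ((a + 1) * Y \<omega>)\<bar> + \<bar>W \<omega> * exp ((a - 1) * Y \<omega>)\<bar>)"
    by (intro Bochner_Integration.integrable_add integrable_abs int)
  have "norm (Y \<omega> * W \<omega> * exp (a * Y \<omega>)) \<le> \<bar>W \<omega> * exp ((a + 1) * Y \<omega>)\<bar> + \<bar>W \<omega> * exp ((a - 1) * Y \<omega>)\<bar>" for \<omega>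
  proof -
    have "\<bar>Y \<omega>\<bar> * (\<bar>W \<omega>\<bar> * exp (a * Y \<omega>)) \<le> (exp (Y \<omega>) + exp (- Y \<omega>)) * (\<bar>W \<omega>\<bar> * exp (a * Y \<omega>))"
      using abs_mult_exp_le[of "Y \<omega>" 0] by (intro mult_right_mono) auto
    then show ?thesis
      by (simp add: abs_mult algebra_simps mult_exp_exp)
  qed
  then show "AE \<omega> in M. norm (Y \<omega> * W \<omega> * exp (a * Y \<omega>)) \<le> norm (\<bar>W \<omega> * exp ((a + 1) * Y \<omega>)\<bar> + \<bar>W \<omega> * exp ((a - 1) * Y \<omega>)\<bar>)"
    by (intro AE_I2) simp
qed measurable

text \<open>
  Differentiation under the integral. The difference quotients at \<open>z\<close> are dominated, for
  increments of size at most \<open>1\<close>, by the integrands at \<open>z + 2\<close> and \<open>z - 2\<close>.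
\<close>
lemma has_real_derivative_exp_weight:
  fixes W Y :: "'a \<Rightarrow> real"
  assumes int: "\<And>a. integrable M (\<lambda>\<omega>. W \<omega> * exp (a * Y \<omega>))"
    and [measurable]: "W \<in> borel_measurable M" "Y \<in> borel_measurable M"
  shows "((\<lambda>z. \<integral>\<omega>. W \<omega> * exp (z * Y \<omega>) \<partial>M) has_real_derivative
     (\<integral>\<omega>. Y \<omega> * W \<omega> * exp (z * Y \<omega>) \<partial>M)) (at z)"
proof -
  let ?q = "\<lambda>d \<omega>. W \<omega> * exp (z * Y \<omega>) * ((exp (d * Y \<omega>) - 1) / d)"
  let ?w = "\<lambda>\<omega>. \<bar>W \<omega> * exp ((z + 2) * Y \<omega>)\<bar> + \<bar>W \<omega> * exp ((z - 2) * Y \<omega>)\<bar>"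
  have quotient: "((\<integral>\<omega>. W \<omega> * exp ((z + d) * Y \<omega>) \<partial>M) - (\<integral>\<omega>. W \<omega> * exp (z * Y \<omega>) \<partial>M)) / d = (\<integral>\<omega>. ?q d \<omega> \<partial>M)" for d
  proof -
    have "?q d \<omega> = (W \<omega> * exp ((z + d) * Y \<omega>) - W \<omega> * exp (z * Y \<omega>)) / d" for \<omega>
      by (simp add: distrib_right exp_add algebra_simps)
    then have "(\<integral>\<omega>. ?q d \<omega> \<partial>M) = (\<integral>\<omega>. (W \<omega> * exp ((z + d) * Y \<omega>) - W \<omega> * exp (z * Y \<omega>)) / d \<partial>M)"
      by (rule Bochner_Integration.integral_cong[OF refl])
    also have "\<dots> = ((\<integral>\<omega>. W \<omega> * exp ((z + d) * Y \<omega>) \<partial>M) - (\<integral>\<omega>. W \<omega> * exp (z * Y \<omega>) \<partial>M)) / d"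
      by (simp add: int)
    finally show ?thesis ..
  qed
  have "((\<lambda>d. \<integral>\<omega>. ?q d \<omega> \<partial>M) \<longlongrightarrow> (\<integral>\<omega>. W \<omega> * exp (z * Y \<omega>) * Y \<omega> \<partial>M)) (at 0)"
    unfolding tendsto_at_iff_sequentially comp_def
  proof (intro allI impI)
    fix X :: "nat \<Rightarrow> real" assume X: "\<forall>i. X i \<in> UNIV - {0}" "X \<longlonglongrightarrow> 0"
    (* Only increments of size at most 1 are dominated, so finitely many are dropped. *)
    then obtain n0 where n0: "\<And>n. n0 \<le> n \<Longrightarrow> \<bar>X n\<bar> < 1"
      using LIMSEQ_D[OF X(2), of 1] by auto
    have "(\<lambda>n. \<integral>\<omega>. ?q (X (n + n0)) \<omega> \<partial>M) \<longlonglongrightarrow> (\<integral>\<omega>. W \<omega> * exp (z * Y \<omega>) * Y \<omega> \<partial>M)"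
    proof (rule integral_dominated_convergence[where w = ?w])
      show "integrable M ?w"
        by (intro Bochner_Integration.integrable_add integrable_abs int)
      have "(\<lambda>n. ?q (X (n + n0)) \<omega>) \<longlonglongrightarrow> W \<omega> * exp (z * Y \<omega>) * Y \<omega>" for \<omega>
      proof -
        have "((\<lambda>d. exp (d * Y \<omega>)) has_real_derivative Y \<omega>) (at 0)"
          by (auto intro!: derivative_eq_intros)
        then have "((\<lambda>d. (exp (d * Y \<omega>) - 1) / d) \<longlongrightarrow> Y \<omega>) (at 0)"
          by (simp add: DERIV_def)
        moreover have "filterlim (\<lambda>n. X (n + n0)) (at 0) sequentially"
          using X LIMSEQ_ignore_initial_segment[OF X(2)] by (auto simp: filterlim_at)
        ultimately have "(\<lambda>n. (exp (X (n + n0) * Y \<omega>) - 1) / X (n + n0)) \<longlonglongrightarrow> Y \<omega>"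
          by (rule filterlim_compose)
        then show ?thesis by (intro tendsto_intros)
      qed
      then show "AE \<omega> in M. (\<lambda>n. ?q (X (n + n0)) \<omega>) \<longlonglongrightarrow> W \<omega> * exp (z * Y \<omega>) * Y \<omega>"
        by simp
      have "norm (?q (X (n + n0)) \<omega>) \<le> ?w \<omega>" for n \<omega>
      proof -
        have "\<bar>(exp (X (n + n0) * Y \<omega>) - 1) / X (n + n0)\<bar> \<le> \<bar>Y \<omega>\<bar> * exp \<bar>Y \<omega>\<bar>"
          using X(1) n0[of "n + n0"] by (intro abs_exp_diff_quotient_le) auto
        also have "\<dots> \<le> exp (2 * Y \<omega>) + exp (- 2 * Y \<omega>)"
          using abs_mult_exp_le[of "Y \<omega>" 1] by simp
        finally have "\<bar>W \<omega>\<bar> * exp (z * Y \<omega>) * \<bar>(exp (X (n + n0) * Y \<omega>) - 1) / X (n + n0)\<bar>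
            \<le> \<bar>W \<omega>\<bar> * exp (z * Y \<omega>) * (exp (2 * Y \<omega>) + exp (- 2 * Y \<omega>))"
          by (intro mult_left_mono) auto
        also have "\<dots> = ?w \<omega>"
          by (simp add: abs_mult algebra_simps mult_exp_exp)
        finally show ?thesis by (simp add: abs_mult)
      qed
      then show "AE \<omega> in M. norm (?q (X (n + n0)) \<omega>) \<le> ?w \<omega>" for n
        by simp
    qed measurable
    then show "(\<lambda>n. \<integral>\<omega>. ?q (X n) \<omega> \<partial>M) \<longlonglongrightarrow> (\<integral>\<omega>. W \<omega> * exp (z * Y \<omega>) * Y \<omega> \<partial>M)"
      by (rule LIMSEQ_offset)
  qed
  moreover have "(\<integral>\<omega>. W \<omega> * exp (z * Y \<omega>) * Y \<omega> \<partial>M) = (\<integral>\<omega>. Y \<omega> * W \<omega> * exp (z * Y \<omega>) \<partial>M)"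
    by (simp add: mult_ac)
  ultimately show ?thesis
    unfolding DERIV_def quotient by simp
qed

text \<open>
  Each differentiation replaces the weight \<open>W\<close> by \<open>Y * W\<close>, for which the same integrability holds. Therefore integrability
  is part of the induction.
\<close>
lemma nth_deriv_exp_weight:
  fixes W Y :: "'a \<Rightarrow> real"
  assumes int: "\<And>a. integrable M (\<lambda>\<omega>. W \<omega> * exp (a * Y \<omega>))"
    and [measurable]: "W \<in> borel_measurable M" "Y \<in> borel_measurable M"
  shows "integrable M (\<lambda>\<omega>. Y \<omega> ^ k * W \<omega> * exp (a * Y \<omega>)) \<and>
    nth_deriv k (\<lambda>z. \<integral>\<omega>. W \<omega> * exp (z * Y \<omega>) \<partial>M) = (\<lambda>z. \<integral>\<omega>. Y \<omega> ^ k * W \<omega> * exp (z * Y \<omega>) \<partial>M)"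
proof (induction k arbitrary: a)
  case 0
  then show ?case using int by (simp add: nth_deriv_def)
next
  case (Suc k)
  have "integrable M (\<lambda>\<omega>. (Y \<omega> ^ k * W \<omega>) * exp (a * Y \<omega>))" for a
    using Suc by blast
  note k = integrable_exp_weight_mult[OF this] has_real_derivative_exp_weight[OF this]
  show ?case
  proof
    show "integrable M (\<lambda>\<omega>. Y \<omega> ^ Suc k * W \<omega> * exp (a * Y \<omega>))"
      using k(1)[of a] by (simp add: mult.assoc)
    have "nth_deriv (Suc k) (\<lambda>z. \<integral>\<omega>. W \<omega> * exp (z * Y \<omega>) \<partial>M)
        = deriv (\<lambda>z. \<integral>\<omega>. Y \<omega> ^ k * W \<omega> * exp (z * Y \<omega>) \<partial>M)"
      using Suc by (simp add: nth_deriv_def)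
    also have "\<dots> = (\<lambda>z. \<integral>\<omega>. Y \<omega> ^ Suc k * W \<omega> * exp (z * Y \<omega>) \<partial>M)"
      using DERIV_imp_deriv[OF k(2)] by (simp add: fun_eq_iff mult.assoc)
    finally show "nth_deriv (Suc k) (\<lambda>z. \<integral>\<omega>. W \<omega> * exp (z * Y \<omega>) \<partial>M)
        = (\<lambda>z. \<integral>\<omega>. Y \<omega> ^ Suc k * W \<omega> * exp (z * Y \<omega>) \<partial>M)" .
  qed
qed

text \<open>
  The inner variable is differentiated with weight \<open>exp (- z1 * X)\<close>, the outer one with weight
  \<open>(- Y) ^ n * exp (- z2 * Y)\<close>. The derivatives are two-sided, so negative arguments of the transform occur and
  the exponential moments are required for all real coefficients.
\<close>
lemma mixed_deriv_laplace2:
  fixes X Y :: "'a \<Rightarrow> real"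
  assumes int: "\<And>a b. integrable M (\<lambda>\<omega>. exp (a * X \<omega> + b * Y \<omega>))"
    and [measurable]: "X \<in> borel_measurable M" "Y \<in> borel_measurable M"
  shows "integrable M (\<lambda>\<omega>. X \<omega> ^ m * Y \<omega> ^ n * exp (- z1 * X \<omega> - z2 * Y \<omega>))" (is ?I)
    and "mixed_deriv m n (laplace2 M X Y) z1 z2
      = (-1) ^ (m + n) * (\<integral>\<omega>. X \<omega> ^ m * Y \<omega> ^ n * exp (- z1 * X \<omega> - z2 * Y \<omega>) \<partial>M)" (is ?D)
proof -
  have inner: "integrable M (\<lambda>\<omega>. (- Y \<omega>) ^ n * exp (a * X \<omega>) * exp (z2 * (- Y \<omega>))) \<and>
      nth_deriv n (laplace2 M X Y z) z2 = (\<integral>\<omega>. (- Y \<omega>) ^ n * exp (- z * X \<omega>) * exp (z2 * (- Y \<omega>)) \<partial>M)" for a z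
  proof -
    have *: "integrable M (\<lambda>\<omega>. (- Y \<omega>) ^ n * exp (c * X \<omega>) * exp (b * (- Y \<omega>))) \<and>
        nth_deriv n (\<lambda>z. \<integral>\<omega>. exp (c * X \<omega>) * exp (z * (- Y \<omega>)) \<partial>M)
          = (\<lambda>z. \<integral>\<omega>. (- Y \<omega>) ^ n * exp (c * X \<omega>) * exp (z * (- Y \<omega>)) \<partial>M)" for b c
    proof (rule nth_deriv_exp_weight)
      show "integrable M (\<lambda>\<omega>. exp (c * X \<omega>) * exp (b * (- Y \<omega>)))" for b
        using int[of c "- b"] by (simp add: mult_exp_exp)
    qed measurable
    have "laplace2 M X Y z = (\<lambda>z2. \<integral>\<omega>. exp (- z * X \<omega>) * exp (z2 * (- Y \<omega>)) \<partial>M)"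
      by (simp add: laplace2_def fun_eq_iff exp_diff exp_minus field_simps)
    then show ?thesis
      using *[of a z2] *[of "- z" z2] by simp
  qed
  let ?W = "\<lambda>\<omega>. (- Y \<omega>) ^ n * exp (z2 * (- Y \<omega>))"
  have "integrable M (\<lambda>\<omega>. ?W \<omega> * exp (a * (- X \<omega>)))" for a
    using inner[of "- a"] by (simp add: mult_ac)
  note outer = nth_deriv_exp_weight[where Y = "\<lambda>\<omega>. - X \<omega>", OF this]
  have eq: "(- X \<omega>) ^ m * ?W \<omega> * exp (z1 * (- X \<omega>))
      = (-1) ^ (m + n) * (X \<omega> ^ m * Y \<omega> ^ n * exp (- z1 * X \<omega> - z2 * Y \<omega>))" for \<omega>
    by (simp add: power_minus[of "X \<omega>"] power_minus[of "Y \<omega>"] power_add exp_diff exp_minus field_simps)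
  have "integrable M (\<lambda>\<omega>. (-1) ^ (m + n) * (X \<omega> ^ m * Y \<omega> ^ n * exp (- z1 * X \<omega> - z2 * Y \<omega>)))"
    using outer[of m z1] unfolding eq by simp
  then show ?I
    by (cases "even (m + n)") simp_all
  have "(\<lambda>z. nth_deriv n (laplace2 M X Y z) z2) = (\<lambda>z. \<integral>\<omega>. ?W \<omega> * exp (z * (- X \<omega>)) \<partial>M)"
    using inner by (simp add: fun_eq_iff mult_ac)
  then have "mixed_deriv m n (laplace2 M X Y) z1 z2 = (\<integral>\<omega>. (- X \<omega>) ^ m * ?W \<omega> * exp (z1 * (- X \<omega>)) \<partial>M)"
    using outer[of m z1] by (simp add: mixed_deriv_def)
  then show ?D
    unfolding eq by simp
qed

section \<open>The mixed Poisson law of the increment\<close>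

context poisson_cluster_model
begin

abbreviation M :: "real \<Rightarrow> 'w \<Rightarrow> nat" where "M \<equiv> cluster_process T L"

lemma R_nonneg: "0 \<le> R t \<omega>"
  unfolding random_sum_def by (intro sum_nonneg \<mu>_nonneg)

lemma R_mono: "0 \<le> s \<Longrightarrow> R t \<omega> \<le> R (t + s) \<omega>"
  unfolding random_sum_def by (intro sum_mono monoD[OF \<mu>_mono]) simp

text \<open>
  The mean value function is bounded, so \<open>R\<close> is at most a constant times the number of points.
\<close>
lemma R_exp_integrable: "integrable P (\<lambda>\<omega>. exp (a * R t \<omega> + b * R u \<omega>))"
proof -
  obtain c where c: "0 \<le> c" "\<And>t. \<mu> t \<le> c" using \<mu>_bounded by blast
  define d where "d = (\<bar>a\<bar> + \<bar>b\<bar>) * c"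
  have R_le: "R t \<omega> \<le> c * N \<omega>" for t \<omega>
    unfolding random_sum_def using sum_bounded_above[of "{..<N \<omega>}" _ c] c(2) by (simp add: mult.commute)
  show ?thesis
  proof (rule Bochner_Integration.integrable_bound[where f = "\<lambda>\<omega>. exp d ^ N \<omega>"])
    show "integrable P (\<lambda>\<omega>. exp d ^ N \<omega>)"
      using point_count_pgf[OF points, of "{0..1}" "exp d"] by (simp add: has_bochner_integral_iff)
    have "a * R t \<omega> + b * R u \<omega> \<le> N \<omega> * d" for \<omega>
    proof -
      have "a * R t \<omega> + b * R u \<omega> \<le> \<bar>a\<bar> * R t \<omega> + \<bar>b\<bar> * R u \<omega>"
        by (intro add_mono mult_right_mono R_nonneg) auto
      also have "\<dots> \<le> \<bar>a\<bar> * (c * N \<omega>) + \<bar>b\<bar> * (c * N \<omega>)"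
        by (intro add_mono mult_left_mono R_le) auto
      finally show ?thesis by (simp add: d_def algebra_simps)
    qed
    then show "AE \<omega> in P. norm (exp (a * R t \<omega> + b * R u \<omega>)) \<le> norm (exp d ^ N \<omega>)"
      by (intro AE_I2) (simp add: exp_of_nat_mult[symmetric])
  qed measurable
qed

text \<open>
  Both sides of \<open>cluster_pgf\<close> are power series in \<open>x\<close> for fixed \<open>y\<close>, and their
  coefficients are in turn power series in \<open>y\<close>. Comparing coefficients twice gives the probabilities.
\<close>
lemma mixed_poisson_joint_law:
  assumes s: "0 \<le> s"
  shows "prob {\<omega>\<in>{\<omega>\<in>space P. M t \<omega> = m}. M (t + s) \<omega> - M t \<omega> = k}
    = expectation (\<lambda>\<omega>. poisson_weight (R t \<omega>) m * poisson_weight (R (t + s) \<omega> - R t \<omega>) k)"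
proof -
  let ?X = "\<lambda>\<omega>. M (t + s) \<omega> - M t \<omega>" and ?D = "\<lambda>\<omega>. R (t + s) \<omega> - R t \<omega>"
  let ?I = "\<lambda>m. indicator {\<omega>\<in>space P. M t \<omega> = m} :: 'w \<Rightarrow> real"
  have D_nonneg: "0 \<le> ?D \<omega>" for \<omega>
    using R_mono[OF s, of t \<omega>] by simp
  have weight_le: "poisson_weight l n \<le> 1" if "0 \<le> l" for l n
    using sums_unique[OF poisson_weight_pgf[of 1 l]] sum_le_suminf[OF sums_summable[OF poisson_weight_pgf[of 1 l]], of "{n}"] that
    by (simp add: poisson_weight_nonneg)
  have exp_neg: "l * (x - 1) \<le> 0" if "0 \<le> l" "x < 1" for l x :: real
    using that by (intro mult_nonneg_nonpos) auto
  have coeff: "expectation (\<lambda>\<omega>. ?I m \<omega> * y ^ ?X \<omega>)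
      = expectation (\<lambda>\<omega>. poisson_weight (R t \<omega>) m * exp (?D \<omega> * (y - 1)))" if y: "0 < y" "y < 1" for y m
  proof (rule power_series_coeff_unique)
    fix x :: real assume x: "0 < x" "x < 1"
    show "(\<lambda>m. expectation (\<lambda>\<omega>. ?I m \<omega> * y ^ ?X \<omega>) * x ^ m) sums
        expectation (\<lambda>\<omega>. x ^ M t \<omega> * y ^ ?X \<omega>)"
    proof -
      have "(\<lambda>m. expectation (\<lambda>\<omega>. ?I m \<omega> * y ^ ?X \<omega> * x ^ m)) sums expectation (\<lambda>\<omega>. x ^ M t \<omega> * y ^ ?X \<omega>)"
      proof (rule nonneg_sums_integral)
        show "integrable P (\<lambda>\<omega>. x ^ M t \<omega> * y ^ ?X \<omega>)"
          using x y by (intro integrable_const_bound[where B = 1] AE_I2) (auto intro!: mult_le_one power_le_one)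
        show "(\<lambda>m. ?I m \<omega> * y ^ ?X \<omega> * x ^ m) sums (x ^ M t \<omega> * y ^ ?X \<omega>)" if "\<omega> \<in> space P" for \<omega>
          using sums_single[of "M t \<omega>" "\<lambda>m. x ^ m * y ^ ?X \<omega>"]
          by (rule sums_cong[THEN iffD1, rotated]) (auto simp: indicator_def that)
      qed (use x y in auto)
      then show ?thesis by simp
    qed
    show "(\<lambda>m. expectation (\<lambda>\<omega>. poisson_weight (R t \<omega>) m * exp (?D \<omega> * (y - 1))) * x ^ m) sums
        expectation (\<lambda>\<omega>. x ^ M t \<omega> * y ^ ?X \<omega>)"
    proof -
      have "(\<lambda>m. expectation (\<lambda>\<omega>. x ^ m * poisson_weight (R t \<omega>) m * exp (?D \<omega> * (y - 1)))) sums
          expectation (\<lambda>\<omega>. exp (R t \<omega> * (x - 1)) * exp (?D \<omega> * (y - 1)))"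
      proof (rule nonneg_sums_integral)
        show "integrable P (\<lambda>\<omega>. exp (R t \<omega> * (x - 1)) * exp (?D \<omega> * (y - 1)))"
          using x y exp_neg R_nonneg D_nonneg
          by (intro integrable_const_bound[where B = 1] AE_I2) (auto intro!: mult_le_one)
        show "(\<lambda>m. x ^ m * poisson_weight (R t \<omega>) m * exp (?D \<omega> * (y - 1))) sums
            (exp (R t \<omega> * (x - 1)) * exp (?D \<omega> * (y - 1)))" for \<omega>
          by (intro sums_mult2 poisson_weight_pgf)
      qed (use x R_nonneg in \<open>auto simp: poisson_weight_nonneg\<close>)
      then show ?thesis
        using cluster_pgf[OF s, of x y t] x y by (simp add: mult_ac)
    qed
  qed
  have "expectation (\<lambda>\<omega>. ?I m \<omega> * indicator {\<omega>\<in>space P. ?X \<omega> = k} \<omega>)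
      = expectation (\<lambda>\<omega>. poisson_weight (R t \<omega>) m * poisson_weight (?D \<omega>) k)"
  proof (rule power_series_coeff_unique)
    fix y :: real assume y: "0 < y" "y < 1"
    show "(\<lambda>k. expectation (\<lambda>\<omega>. ?I m \<omega> * indicator {\<omega>\<in>space P. ?X \<omega> = k} \<omega>) * y ^ k) sums
        expectation (\<lambda>\<omega>. ?I m \<omega> * y ^ ?X \<omega>)"
    proof -
      have "(\<lambda>k. expectation (\<lambda>\<omega>. ?I m \<omega> * indicator {\<omega>\<in>space P. ?X \<omega> = k} \<omega> * y ^ k)) sums
          expectation (\<lambda>\<omega>. ?I m \<omega> * y ^ ?X \<omega>)"
      proof (rule nonneg_sums_integral)
        show "integrable P (\<lambda>\<omega>. ?I m \<omega> * y ^ ?X \<omega>)"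
          using y by (intro integrable_const_bound[where B = 1] AE_I2) (auto intro!: mult_le_one power_le_one simp: indicator_def)
        show "(\<lambda>k. ?I m \<omega> * indicator {\<omega>\<in>space P. ?X \<omega> = k} \<omega> * y ^ k) sums (?I m \<omega> * y ^ ?X \<omega>)" if "\<omega> \<in> space P" for \<omega>
          using sums_single[of "?X \<omega>" "\<lambda>k. ?I m \<omega> * y ^ k"]
          by (rule sums_cong[THEN iffD1, rotated]) (auto simp: indicator_def that)
      qed (use y in auto)
      then show ?thesis by simp
    qed
    show "(\<lambda>k. expectation (\<lambda>\<omega>. poisson_weight (R t \<omega>) m * poisson_weight (?D \<omega>) k) * y ^ k) sums
        expectation (\<lambda>\<omega>. ?I m \<omega> * y ^ ?X \<omega>)"
    proof -
      have "(\<lambda>k. expectation (\<lambda>\<omega>. poisson_weight (R t \<omega>) m * (y ^ k * poisson_weight (?D \<omega>) k))) sums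
          expectation (\<lambda>\<omega>. poisson_weight (R t \<omega>) m * exp (?D \<omega> * (y - 1)))"
      proof (rule nonneg_sums_integral)
        show "integrable P (\<lambda>\<omega>. poisson_weight (R t \<omega>) m * exp (?D \<omega> * (y - 1)))"
          using y exp_neg R_nonneg D_nonneg weight_le
          by (intro integrable_const_bound[where B = 1] AE_I2) (auto intro!: mult_le_one simp: abs_mult poisson_weight_nonneg)
        show "(\<lambda>k. poisson_weight (R t \<omega>) m * (y ^ k * poisson_weight (?D \<omega>) k)) sums
            (poisson_weight (R t \<omega>) m * exp (?D \<omega> * (y - 1)))" for \<omega>
          by (intro sums_mult poisson_weight_pgf)
      qed (use y R_nonneg D_nonneg in \<open>auto simp: poisson_weight_nonneg\<close>)
      then show ?thesis
        unfolding coeff[OF y] by (simp add: mult_ac)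
    qed
  qed
  moreover have "expectation (\<lambda>\<omega>. ?I m \<omega> * indicator {\<omega>\<in>space P. ?X \<omega> = k} \<omega>)
      = expectation (indicator {\<omega>\<in>{\<omega>\<in>space P. M t \<omega> = m}. ?X \<omega> = k})"
    by (intro Bochner_Integration.integral_cong) (auto simp: indicator_def)
  moreover have "{\<omega>\<in>{\<omega>\<in>space P. M t \<omega> = m}. ?X \<omega> = k} = {\<omega>\<in>space P. M t \<omega> = m \<and> ?X \<omega> = k}"
    by auto
  ultimately show ?thesis by simp
qed

text \<open>
  Functions of the increment can be averaged under a Poisson law with mean \<open>D\<close>, on the event
  \<open>M(t) = m\<close> with weight \<open>poisson_weight R m\<close>. The cases \<open>f = 1\<close>, \<open>k\<close>, \<open>k\<^sup>2\<close> will be used.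
\<close>
lemma increment_moment_on_event:
  assumes s: "0 \<le> s" and f: "\<And>k. 0 \<le> f k" and F: "\<And>l. (\<lambda>k. f k * poisson_weight l k) sums F l"
    and int: "integrable P (\<lambda>\<omega>. poisson_weight (R t \<omega>) m * F (R (t + s) \<omega> - R t \<omega>))"
  shows "has_bochner_integral P (\<lambda>\<omega>. f (M (t + s) \<omega> - M t \<omega>) * indicator {\<omega>\<in>space P. M t \<omega> = m} \<omega>)
      (expectation (\<lambda>\<omega>. poisson_weight (R t \<omega>) m * F (R (t + s) \<omega> - R t \<omega>)))"
proof (rule has_bochner_integral_nat_valued[OF _ _ f])
  have D_nonneg: "0 \<le> R (t + s) \<omega> - R t \<omega>" for \<omega>
    using R_mono[OF s, of t \<omega>] by simp
  have "(\<lambda>k. expectation (\<lambda>\<omega>. poisson_weight (R t \<omega>) m * (f k * poisson_weight (R (t + s) \<omega> - R t \<omega>) k))) sums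
      expectation (\<lambda>\<omega>. poisson_weight (R t \<omega>) m * F (R (t + s) \<omega> - R t \<omega>))"
    using f D_nonneg R_nonneg
    by (intro nonneg_sums_integral int sums_mult F) (auto simp: poisson_weight_nonneg)
  then show "(\<lambda>k. f k * prob {\<omega>\<in>{\<omega>\<in>space P. M t \<omega> = m}. M (t + s) \<omega> - M t \<omega> = k}) sums
      expectation (\<lambda>\<omega>. poisson_weight (R t \<omega>) m * F (R (t + s) \<omega> - R t \<omega>))"
    unfolding mixed_poisson_joint_law[OF s] by (simp add: mult_ac)
qed measurable

text \<open>
  A linear combination of the two random sums is again a sum of one bounded continuous function over points or
  marks, to which the Laplace functionals apply.
\<close>
lemma random_sum_laplace2:
  assumes pos: "0 < emeasure \<Lambda> {0..1}"
    and V: "indep_vars (\<lambda>_. borel) V UNIV" "\<And>j. distr P borel (V j) = uniform_measure \<Lambda> {0..1}"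
    and TV: "indep_elements P (PiM UNIV (\<lambda>_. borel)) (\<lambda>\<omega> j. T j \<omega>) (PiM UNIV (\<lambda>_. borel)) (\<lambda>\<omega> j. V j \<omega>)"
  shows "laplace2 P (random_sum T \<mu> V t) (random_sum T \<mu> V u) = laplace2 P (R t) (R u)"
proof (intro ext)
  fix z1 z2
  define h where "h x = - z1 * \<mu> (t - x) - z2 * \<mu> (u - x)" for x
  obtain c where c: "0 \<le> c" "\<And>t. \<mu> t \<le> c" using \<mu>_bounded by blast
  have h_bound: "\<bar>h x\<bar> \<le> (\<bar>z1\<bar> + \<bar>z2\<bar>) * c" for x
  proof -
    have "\<bar>h x\<bar> \<le> \<bar>z1 * \<mu> (t - x)\<bar> + \<bar>z2 * \<mu> (u - x)\<bar>"
      unfolding h_def by linarith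
    also have "\<dots> \<le> \<bar>z1\<bar> * c + \<bar>z2\<bar> * c"
      unfolding abs_mult using c \<mu>_nonneg by (intro add_mono mult_left_mono) auto
    finally show ?thesis by (simp add: algebra_simps)
  qed
  have h_cont: "continuous_on UNIV h"
    unfolding h_def by (intro continuous_intros continuous_on_compose2[OF \<mu>_continuous]) auto
  have exponent: "- z1 * random_sum T \<mu> W t \<omega> - z2 * random_sum T \<mu> W u \<omega> = (\<Sum>j<N \<omega>. h (W j \<omega>))" for W \<omega>
    by (simp add: random_sum_def h_def sum_subtractf sum_distrib_left sum_negf)
  show "laplace2 P (random_sum T \<mu> V t) (random_sum T \<mu> V u) z1 z2 = laplace2 P (R t) (R u) z1 z2"
    unfolding laplace2_def exponent
    using iid_marks_laplace_functional[OF points pos V TV borel_measurable_continuous_onI[OF h_cont] h_bound]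
      point_process_laplace_functional[OF points h_cont h_bound]
    by simp
qed

section \<open>Conditional moments and the prediction formulas\<close>

text \<open>
  \<open>C f\<close> stands for $E[R^mf(D)e^{-R}]$. Conditioning divides by the probability of the event, and the factor
  $1/m!$ cancels.
\<close>
lemma conditional_moments:
  fixes t s :: real and m :: nat
  assumes s: "0 \<le> s"
  defines "A \<equiv> {\<omega>\<in>space P. M t \<omega> = m}"
  defines "C \<equiv> \<lambda>f. expectation (\<lambda>\<omega>. R t \<omega> ^ m * f (R (t + s) \<omega> - R t \<omega>) * exp (- R t \<omega>))"
  assumes A: "0 < prob A"
  shows "C (\<lambda>_. 1) \<noteq> 0"
    and "expectation_given P A (cluster_increment T L t s) = C (\<lambda>d. d) / C (\<lambda>_. 1)"
    and "variance_given P A (cluster_increment T L t s)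
      = (C (\<lambda>d. d\<^sup>2) + C (\<lambda>d. d)) / C (\<lambda>_. 1) - (C (\<lambda>d. d) / C (\<lambda>_. 1))\<^sup>2"
proof -
  let ?X = "cluster_increment T L t s" and ?D = "\<lambda>\<omega>. R (t + s) \<omega> - R t \<omega>"
  have X_eq: "?X \<omega> = real (M (t + s) \<omega> - M t \<omega>)" if "\<omega> \<in> space P" for \<omega>
    using cluster_process_mono[OF that s, of t] by (simp add: cluster_increment_def of_nat_diff)
  have A_sets [measurable]: "A \<in> events"
    unfolding A_def by measurable
  have X_measurable [measurable]: "?X \<in> borel_measurable P"
    unfolding cluster_increment_def by measurable
  have weight: "poisson_weight (R t \<omega>) m * f (?D \<omega>) = R t \<omega> ^ m * f (?D \<omega>) * exp (- R t \<omega>) / fact m" for f \<omega>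
    by (simp add: poisson_weight_def)
  have int_R: "integrable P (\<lambda>\<omega>. R t \<omega> ^ i * R (t + s) \<omega> ^ j * exp (- R t \<omega>))" for i j
    using mixed_deriv_laplace2(1)[OF R_exp_integrable R_measurable R_measurable, of t i "t + s" j 1 0] by simp
  have int0: "integrable P (\<lambda>\<omega>. R t \<omega> ^ m * 1 * exp (- R t \<omega>))"
    using int_R[of m 0] by simp
  have "integrable P (\<lambda>\<omega>. R t \<omega> ^ m * R (t + s) \<omega> ^ 1 * exp (- R t \<omega>) - R t \<omega> ^ (m + 1) * R (t + s) \<omega> ^ 0 * exp (- R t \<omega>))"
    by (intro Bochner_Integration.integrable_diff int_R)
  then have int1: "integrable P (\<lambda>\<omega>. R t \<omega> ^ m * ?D \<omega> * exp (- R t \<omega>))"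
    by (simp add: algebra_simps)
  have "integrable P (\<lambda>\<omega>. R t \<omega> ^ m * R (t + s) \<omega> ^ 2 * exp (- R t \<omega>)
      - 2 * (R t \<omega> ^ (m + 1) * R (t + s) \<omega> ^ 1 * exp (- R t \<omega>)) + R t \<omega> ^ (m + 2) * R (t + s) \<omega> ^ 0 * exp (- R t \<omega>))"
    by (intro Bochner_Integration.integrable_diff Bochner_Integration.integrable_add integrable_mult_right int_R)
  then have int2: "integrable P (\<lambda>\<omega>. R t \<omega> ^ m * (?D \<omega>)\<^sup>2 * exp (- R t \<omega>))"
    by (simp add: power2_eq_square algebra_simps)
  have moment: "has_bochner_integral P (\<lambda>\<omega>. f (M (t + s) \<omega> - M t \<omega>) * indicator A \<omega>) (C F / fact m)"
    if "\<And>k. 0 \<le> f k" "\<And>l. (\<lambda>k. f k * poisson_weight l k) sums F l"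
      "integrable P (\<lambda>\<omega>. R t \<omega> ^ m * F (?D \<omega>) * exp (- R t \<omega>))" for f F
    using increment_moment_on_event[OF s that(1,2), of t m] that(3) unfolding weight A_def C_def by simp
  have C2: "C (\<lambda>d. d\<^sup>2 + d) = C (\<lambda>d. d\<^sup>2) + C (\<lambda>d. d)"
    unfolding C_def using int1 int2
    by (subst Bochner_Integration.integral_add[symmetric]) (simp_all add: algebra_simps)
  have "has_bochner_integral P (\<lambda>\<omega>. 1 * indicator A \<omega>) (C (\<lambda>_. 1) / fact m)"
    using poisson_weight_pgf[of 1] int0 by (intro moment) simp_all
  then have prob_A: "prob A = C (\<lambda>_. 1) / fact m"
    by (simp add: has_bochner_integral_iff)
  then show C1: "C (\<lambda>_. 1) \<noteq> 0"
    using A by auto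
  have X1: "has_bochner_integral P (\<lambda>\<omega>. ?X \<omega> * indicator A \<omega>) (C (\<lambda>d. d) / fact m)"
    using moment[of real "\<lambda>d. d"] poisson_weight_mean int1 X_eq
    by (subst has_bochner_integral_cong[OF refl _ refl]) auto
  have X2: "has_bochner_integral P (\<lambda>\<omega>. (?X \<omega>)\<^sup>2 * indicator A \<omega>) ((C (\<lambda>d. d\<^sup>2) + C (\<lambda>d. d)) / fact m)"
  proof -
    have "integrable P (\<lambda>\<omega>. R t \<omega> ^ m * ((?D \<omega>)\<^sup>2 + ?D \<omega>) * exp (- R t \<omega>))"
      using Bochner_Integration.integrable_add[OF int2 int1] by (simp add: algebra_simps)
    then have "has_bochner_integral P (\<lambda>\<omega>. (real (M (t + s) \<omega> - M t \<omega>))\<^sup>2 * indicator A \<omega>) (C (\<lambda>d. d\<^sup>2 + d) / fact m)"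
      using poisson_weight_second_moment by (intro moment) auto
    then show ?thesis
      unfolding C2 using X_eq by (subst has_bochner_integral_cong[OF refl _ refl]) auto
  qed
  have given: "has_bochner_integral (uniform_measure P A) f (c / C (\<lambda>_. 1))"
    if "has_bochner_integral P (\<lambda>\<omega>. f \<omega> * indicator A \<omega>) (c / fact m)" "f \<in> borel_measurable P" for f c
    using has_bochner_integral_uniform_measure[OF A_sets _ _ that] A
    by (simp add: emeasure_eq_measure prob_A)
  show mean: "expectation_given P A ?X = C (\<lambda>d. d) / C (\<lambda>_. 1)"
    unfolding expectation_given_def using given[OF X1] by (simp add: has_bochner_integral_iff)
  interpret U: prob_space "uniform_measure P A"
    using A by (intro prob_space_uniform_measure) (simp_all add: emeasure_eq_measure)
  have "variance_given P A ?X = U.expectation (\<lambda>\<omega>. (?X \<omega>)\<^sup>2) - (U.expectation ?X)\<^sup>2"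
    unfolding variance_given_def expectation_given_def
    using given[OF X1] given[OF X2] by (intro U.variance_eq) (simp_all add: has_bochner_integral_iff)
  then show "variance_given P A ?X = (C (\<lambda>d. d\<^sup>2) + C (\<lambda>d. d)) / C (\<lambda>_. 1) - (C (\<lambda>d. d) / C (\<lambda>_. 1))\<^sup>2"
    using given[OF X1] given[OF X2] by (simp add: has_bochner_integral_iff)
qed

text \<open>
  In the expansion of \<open>R ^ m * (R' - R) ^ i\<close> all terms have total degree \<open>m + i\<close>, so the corresponding
  derivatives at \<open>(1, 0)\<close> share the sign \<open>(-1) ^ (m + i)\<close>. The factor \<open>(-1) ^ i\<close> turns \<open>(R' - R) ^ i\<close> into
  \<open>(R - R') ^ i\<close>, whose binomial coefficients appear on the left-hand sides.
\<close>
lemma laplace2_derivatives: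
  fixes t s :: real and m :: nat
  assumes s: "0 \<le> s"
  defines "C \<equiv> \<lambda>f. expectation (\<lambda>\<omega>. R t \<omega> ^ m * f (R (t + s) \<omega> - R t \<omega>) * exp (- R t \<omega>))"
    and "\<phi> \<equiv> laplace2 P (R t) (R (t + s))"
  shows "mixed_deriv m 0 \<phi> 1 0 = (-1) ^ m * C (\<lambda>_. 1)"
    and "mixed_deriv (m + 1) 0 \<phi> 1 0 - mixed_deriv m 1 \<phi> 1 0 = (-1) ^ m * C (\<lambda>d. d)"
    and "mixed_deriv (m + 2) 0 \<phi> 1 0 - 2 * mixed_deriv (m + 1) 1 \<phi> 1 0 + mixed_deriv m 2 \<phi> 1 0
      = (-1) ^ m * C (\<lambda>d. d\<^sup>2)"
proof -
  define E where "E i j \<omega> = R t \<omega> ^ i * R (t + s) \<omega> ^ j * exp (- R t \<omega>)" for i j \<omega>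
  have int [simp]: "integrable P (E i j)" for i j
    using mixed_deriv_laplace2(1)[OF R_exp_integrable R_measurable R_measurable, of t i "t + s" j 1 0]
    by (simp add: E_def[abs_def])
  have deriv: "mixed_deriv i j \<phi> 1 0 = (-1) ^ (i + j) * expectation (E i j)" for i j
    using mixed_deriv_laplace2(2)[OF R_exp_integrable R_measurable R_measurable, of i j t "t + s" 1 0]
    by (simp add: E_def[abs_def] \<phi>_def)
  have C0: "C (\<lambda>_. 1) = expectation (E m 0)"
    by (simp add: C_def E_def[abs_def])
  have "C (\<lambda>d. d) = expectation (\<lambda>\<omega>. E m 1 \<omega> - E (m + 1) 0 \<omega>)"
    unfolding C_def E_def by (intro Bochner_Integration.integral_cong refl) (simp add: algebra_simps)
  then have C1: "C (\<lambda>d. d) = expectation (E m 1) - expectation (E (m + 1) 0)"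
    by simp
  have "C (\<lambda>d. d\<^sup>2) = expectation (\<lambda>\<omega>. E m 2 \<omega> - 2 * E (m + 1) 1 \<omega> + E (m + 2) 0 \<omega>)"
    unfolding C_def E_def
    by (intro Bochner_Integration.integral_cong refl) (simp add: power2_eq_square algebra_simps)
  then have C2: "C (\<lambda>d. d\<^sup>2) = expectation (E m 2) - 2 * expectation (E (m + 1) 1) + expectation (E (m + 2) 0)"
    by simp
  show "mixed_deriv m 0 \<phi> 1 0 = (-1) ^ m * C (\<lambda>_. 1)"
    "mixed_deriv (m + 1) 0 \<phi> 1 0 - mixed_deriv m 1 \<phi> 1 0 = (-1) ^ m * C (\<lambda>d. d)"
    "mixed_deriv (m + 2) 0 \<phi> 1 0 - 2 * mixed_deriv (m + 1) 1 \<phi> 1 0 + mixed_deriv m 2 \<phi> 1 0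
      = (-1) ^ m * C (\<lambda>d. d\<^sup>2)"
    unfolding deriv C0 C1 C2 by (simp_all add: algebra_simps)
qed

end

theorem theorem2p4:
  fixes P :: "'w measure"
    and \<Lambda> :: "real measure"
    and \<mu> :: "real \<Rightarrow> real"
    and T :: "nat \<Rightarrow> 'w \<Rightarrow> ereal"
    and L :: "nat \<Rightarrow> real \<Rightarrow> 'w \<Rightarrow> nat"
    and V :: "nat \<Rightarrow> 'w \<Rightarrow> real"
    and t s :: real and m :: nat
  defines "A \<equiv> {\<omega> \<in> space P. cluster_process T L t \<omega> = m}"
    and "\<phi>1 \<equiv> laplace P (random_sum T \<mu> V t)"
    and "\<phi>2 \<equiv> laplace2 P (random_sum T \<mu> V t) (random_sum T \<mu> V (t + s))"
  defines "Mhat \<equiv> expectation_given P A (cluster_increment T L t s)"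
  assumes "prob_space P"
    and "poisson_point_process P \<Lambda> T"
    and "0 < emeasure \<Lambda> {0..1}" and "emeasure \<Lambda> {0..1} < \<infinity>"
    and "finite_mean_value_function \<mu>"
    and "iid_poisson_clusters P \<mu> L"
    and "indep_elements P
           (PiM UNIV (\<lambda>_. borel)) (\<lambda>\<omega> j. T j \<omega>)
           (PiM UNIV (\<lambda>_. PiM UNIV (\<lambda>_. count_space UNIV))) (\<lambda>\<omega> j u. L j u \<omega>)"
    and "prob_space.indep_vars P (\<lambda>_. borel) V UNIV"
    and "\<And>j. distr P borel (V j) = uniform_measure \<Lambda> {0..1}"
    and "indep_elements P
           (PiM UNIV (\<lambda>_. borel)) (\<lambda>\<omega> j. T j \<omega>)
           (PiM UNIV (\<lambda>_. borel)) (\<lambda>\<omega> j. V j \<omega>)"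
    and "1 \<le> t" and "0 < s" and "1 \<le> m"
    and "0 < measure P A"
  shows "Mhat = (mixed_deriv (m + 1) 0 \<phi>2 1 0 - mixed_deriv m 1 \<phi>2 1 0) / nth_deriv m \<phi>1 1 \<and>
         variance_given P A (cluster_increment T L t s) =
           (mixed_deriv (m + 2) 0 \<phi>2 1 0 - 2 * mixed_deriv (m + 1) 1 \<phi>2 1 0
              + mixed_deriv m 2 \<phi>2 1 0) / nth_deriv m \<phi>1 1 + Mhat - Mhat\<^sup>2"
proof -
  interpret poisson_cluster_model P \<Lambda> \<mu> T L
    by (rule poisson_cluster_model.intro) (use assms in \<open>auto intro: poisson_cluster_model_axioms.intro\<close>)
  define C where "C f = expectation (\<lambda>\<omega>. R t \<omega> ^ m * f (R (t + s) \<omega> - R t \<omega>) * exp (- R t \<omega>))" for f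
  have s: "0 \<le> s" using \<open>0 < s\<close> by simp
  (* From here on the random sums are functions of the points, on which M(t) depends as well. *)
  have \<phi>2: "\<phi>2 = laplace2 P (R t) (R (t + s))"
    unfolding \<phi>2_def by (rule random_sum_laplace2) fact+
  have "\<phi>1 = (\<lambda>z. \<phi>2 z 0)"
    by (simp add: \<phi>1_def \<phi>2_def laplace_def laplace2_def fun_eq_iff)
  then have "nth_deriv m \<phi>1 1 = mixed_deriv m 0 \<phi>2 1 0"
    by (simp add: mixed_deriv_def nth_deriv_def)
  note derivs = this laplace2_derivatives[OF s, of m t, folded C_def \<phi>2]
  note moments = conditional_moments[OF s, of t m, folded A_def C_def, OF \<open>0 < measure P A\<close>]
  have cancel: "(-1) ^ m * a / ((-1) ^ m * b) = a / b" for a b :: real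
    by simp
  show ?thesis
    unfolding derivs Mhat_def moments(2,3) cancel by (simp add: add_divide_distrib)
qed

end
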